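(* Let $\mathcal{S}$ be an addable abstract numeration system. Let $\mathbf{x}$ be an $\mathcal{S}$-automatic infinite word over a finite alphabet $A$ with sublinear factor complexity, i.e. $\rho_{\mathbf{x}}(n)=\mathcal{O}(n)$, and let $X$ be the subshift generated by $\mathbf{x}$ (its orbit closure). Then the winning shift $W(X)\subseteq\mathbb{N}^{\mathbb{N}}$ is $\mathcal{S}$-codable.
   Context: Subshifts are one-sided: a subshift is a closed (product topology) shift-invariant subset of $A^{\mathbb{N}}$; the subshift generated by $\mathbf{x}$ is the closure of $\{$shifts of $\mathbf{x}\}$. $\rho_{\mathbf{x}}(n)$ is the number of distinct factors of length $n$ of $\mathbf{x}$. Winning shift: for $X\subseteq A^{\mathbb{N}}$ and a choice sequence $\alpha=\alpha_0\alpha_1\cdots\in\{0,\dots,|A|-1\}^{\mathbb{N}}$, Alice and Bob play infinitely many rounds; in round $j$ Alice chooses $A_j\subseteq A$ with $|A_j|=\alpha_j+1$ and Bob chooses $a_j\in A_j$; Alice wins if $a_0a_1\cdots\in X$. $W(X)$ is the set of $\alpha$ for which Alice has a winning strategy (for subshifts $X$ it is a subshift of $\{0,\dots,|A|-1\}^{\mathbb{N}}\subseteq\mathbb{N}^{\mathbb{N}}$). Abstract numeration system (ANS): $\mathcal{S}=(L,\prec)$ with $L$ an infinite language over a finite alphabet and $\prec$ a total order on $L$ of order type $\omega$; $\mathrm{rep}(n)$ is the $n$-th word of $L$ (starting from $n=0$) and $\mathrm{val}=\mathrm{rep}^{-1}$. For $(n_1,\dots,n_d)\in\mathbb{N}^d$,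 $\mathrm{rep}(n_1,\dots,n_d)$ is the word over $(\Sigma\cup\{\#\})^d$ obtained by left-padding the words $\mathrm{rep}(n_i)$ with a new symbol $\#$ to a common length. $Y\subseteq\mathbb{N}^d$ is $\mathcal{S}$-recognizable if $\mathrm{rep}(Y)$ is a regular language. $\mathcal{S}$ is addable if $\{(x,y,x+y):x,y\in\mathbb{N}\}$ is $\mathcal{S}$-recognizable. An infinite word $\mathbf{x}$ is $\mathcal{S}$-automatic if there is a deterministic finite automaton with output whose output on input $\mathrm{rep}(n)$ is $\mathbf{x}[n]$ for all $n\ge0$. Codability: for $\mathbf{y}=y_0y_1\cdots\in\mathbb{N}^{\mathbb{N}}$ put $\sum\mathbf{y}=\sum_i y_i$. If $\sum\mathbf{y}=d<\infty$, $\nu(\mathbf{y})$ is the unique $(n_1,\dots,n_d)\in\mathbb{N}^d$ with $n_1\le\dots\le n_d$ and $y_j=|\{k:n_k=j\}|$ for all $j$. The coding dimension of $Y\subseteq\mathbb{N}^{\mathbb{N}}$ is the least $d$ with $\sum\mathbf{y}\le d$ for all $\mathbf{y}\in Y$, if it exists (otherwise $Y$ has infinite coding dimension). $Y$ is weakly $\mathcal{S}$-codable if for every $k\in\mathbb{N}$ the set $\{\nu(\mathbf{y}):\mathbf{y}\in Y,\sum\mathbf{y}\le k\}\subseteq\mathbb{N}^{\le k}$ is $\mathcal{S}$-recognizable (a subset of $\mathbb{N}\cup\dots\cup\mathbb{N}^k$ is $\mathcal{S}$-recognizable if its intersection with each $\mathbb{N}^i$ is); $Y$ is $\mathcal{S}$-codable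 if it is weakly $\mathcal{S}$-codable and has finite coding dimension. *)

theory Defs
  imports "HOL-Analysis.Analysis" "HOL-Library.Landau_Symbols"
begin

definition regular_lang :: "'c list set \<Rightarrow> bool" where
  "regular_lang L \<longleftrightarrow>
     (\<exists>(Q::nat set) q0 (\<delta>::nat \<Rightarrow> 'c \<Rightarrow> nat) F.
        finite Q \<and> q0 \<in> Q \<and> (\<forall>q\<in>Q. \<forall>c. \<delta> q c \<in> Q) \<and> F \<subseteq> Q \<and>
        L = {w. foldl \<delta> q0 w \<in> F})"

text \<open>An ANS (L, \<prec>) with order type omega is given by its enumeration
  rep : nat -> L (the n-th word of L), a bijection onto the infinite language L.\<close>
definition ANS :: "(nat \<Rightarrow> 'b::finite list) \<Rightarrow> bool" where
  "ANS rep \<longleftrightarrow> inj rep"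

text \<open>Padded representation of a tuple (n_1,...,n_d), given as a list of length d:
  each rep n_i is left-padded with # (= None) to the common length.\<close>
definition rep_tuple :: "(nat \<Rightarrow> 'b list) \<Rightarrow> nat list \<Rightarrow> 'b option list list" where
  "rep_tuple rep ns =
     (let m = Max (insert 0 (set (map (\<lambda>n. length (rep n)) ns))) in
      map (\<lambda>i. map (\<lambda>n. if i < m - length (rep n) then None
                         else Some (rep n ! (i - (m - length (rep n))))) ns) [0..<m])"

definition recognizable :: "(nat \<Rightarrow> 'b list) \<Rightarrow> nat \<Rightarrow> nat list set \<Rightarrow> bool" where
  "recognizable rep d Y \<longleftrightarrow> Y \<subseteq> {ns. length ns = d} \<and> regular_lang (rep_tuple rep ` Y)"

definition recognizable_le :: "(nat \<Rightarrow> 'b list) \<Rightarrow> nat \<Rightarrow> nat list set \<Rightarrow> bool" where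
  "recognizable_le rep k Y \<longleftrightarrow> Y \<subseteq> {ns. length ns \<le> k} \<and>
     (\<forall>i\<le>k. recognizable rep i {ns \<in> Y. length ns = i})"

definition addable :: "(nat \<Rightarrow> 'b list) \<Rightarrow> bool" where
  "addable rep \<longleftrightarrow> recognizable rep 3 {[x, y, x + y] | x y. True}"

definition automatic :: "(nat \<Rightarrow> 'b list) \<Rightarrow> (nat \<Rightarrow> 'a) \<Rightarrow> bool" where
  "automatic rep x \<longleftrightarrow>
     (\<exists>(Q::nat set) q0 (\<delta>::nat \<Rightarrow> 'b \<Rightarrow> nat) (out::nat \<Rightarrow> 'a).
        finite Q \<and> q0 \<in> Q \<and> (\<forall>q\<in>Q. \<forall>c. \<delta> q c \<in> Q) \<and>
        (\<forall>n. x n = out (foldl \<delta> q0 (rep n))))"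

definition factors :: "(nat \<Rightarrow> 'a) \<Rightarrow> nat \<Rightarrow> 'a list set" where
  "factors x n = {map (\<lambda>j. x (i + j)) [0..<n] | i. True}"

definition factor_complexity :: "(nat \<Rightarrow> 'a) \<Rightarrow> nat \<Rightarrow> nat" where
  "factor_complexity x n = card (factors x n)"

definition seq_topology :: "(nat \<Rightarrow> 'a) topology" where
  "seq_topology = product_topology (\<lambda>_. discrete_topology UNIV) UNIV"

definition shift :: "(nat \<Rightarrow> 'a) \<Rightarrow> nat \<Rightarrow> 'a" where
  "shift x = (\<lambda>n. x (Suc n))"

definition generated_subshift :: "(nat \<Rightarrow> 'a) \<Rightarrow> (nat \<Rightarrow> 'a) set" where
  "generated_subshift x = seq_topology closure_of {(shift ^^ k) x | k. True}"

text \<open>Alice's strategy maps the history of Bob's previous choices to her set A_j.\<close>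
definition winning_shift :: "(nat \<Rightarrow> 'a::finite) set \<Rightarrow> (nat \<Rightarrow> nat) set" where
  "winning_shift X =
     {\<alpha>. (\<forall>j. \<alpha> j < CARD('a)) \<and>
          (\<exists>\<sigma> :: 'a list \<Rightarrow> 'a set.
             (\<forall>h. card (\<sigma> h) = \<alpha> (length h) + 1) \<and>
             (\<forall>b. (\<forall>j. b j \<in> \<sigma> (map b [0..<j])) \<longrightarrow> b \<in> X))}"

definition seq_sum_le :: "(nat \<Rightarrow> nat) \<Rightarrow> nat \<Rightarrow> bool" where
  "seq_sum_le y d \<longleftrightarrow> finite {i. y i \<noteq> 0} \<and> (\<Sum>i\<in>{i. y i \<noteq> 0}. y i) \<le> d"

definition nu :: "(nat \<Rightarrow> nat) \<Rightarrow> nat list" where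
  "nu y = (THE ns. sorted ns \<and> (\<forall>j. count_list ns j = y j))"

definition finite_coding_dimension :: "(nat \<Rightarrow> nat) set \<Rightarrow> bool" where
  "finite_coding_dimension Y \<longleftrightarrow> (\<exists>d. \<forall>y\<in>Y. seq_sum_le y d)"

definition weakly_codable :: "(nat \<Rightarrow> 'b list) \<Rightarrow> (nat \<Rightarrow> nat) set \<Rightarrow> bool" where
  "weakly_codable rep Y \<longleftrightarrow> (\<forall>k. recognizable_le rep k {nu y | y. y \<in> Y \<and> seq_sum_le y k})"

definition codable :: "(nat \<Rightarrow> 'b list) \<Rightarrow> (nat \<Rightarrow> nat) set \<Rightarrow> bool" where
  "codable rep Y \<longleftrightarrow> weakly_codable rep Y \<and> finite_coding_dimension Y"

end

theory Submission
  imports Defs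
begin

text \<open>
  A language is regular iff it has finitely many left quotients. With addition recognizable, the
  recognizable relations contain the order and are closed under Boolean operations, quantifiers
  and reindexing of coordinates. Every factor of \<open>x\<close> extends to a point of the orbit closure, so for a
  choice sequence of finite sum the existence of a winning strategy only concerns the finitely
  many positions with a real choice. Histories are represented by their occurrences in \<open>x\<close>, which
  turns it into a first-order condition on these positions.

  For the coding dimension, if a choice sequence with \<open>k\<close> nonzero entries before a nonzero entry
  at \<open>n\<close> is winning, then \<open>x\<close> has at least \<open>2 ^ k\<close> right special factors of length \<open>n\<close>. By a theorem
  of Cassaigne their number is bounded when the complexity is linear. To see this, let \<open>m = n div 4\<close>
  and count windows of length \<open>2 * n\<close> around extensions of right special factors, at \<open>m\<close> different
  shifts. If the suffix of the factor starting at \<open>m\<close> has a period \<open>\<le> m\<close>, choose the extension that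
  breaks the period: the break is visible in the window and determines the shift. The other factors
  occurring in a common window \<open>v\<close> are extended by a letter different from that of \<open>v\<close>, and two
  coinciding windows around them would create such a period. Linearly many windows thus leave room
  for boundedly many right special factors.
\<close>

subsection \<open>Relations definable in an addable numeration system\<close>

definition lquot :: "'c list set \<Rightarrow> 'c list \<Rightarrow> 'c list set" where
  "lquot L u = {v. u @ v \<in> L}"

definition fin_index :: "'c list set \<Rightarrow> bool" where
  "fin_index L \<longleftrightarrow> finite (range (lquot L))"

text \<open>Here \<open>f\<close> acts as the state reached by an automaton and \<open>g\<close> as
  the language accepted from a state. No compatibility of \<open>f\<close> with appending letters
  has to be checked, which keeps the closure proofs short.\<close>

lemma fin_indexI:
  assumes "finite (range f)" and "\<And>u. lquot L u = g (f u)"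
  shows "fin_index L"
proof -
  have "range (lquot L) = g ` range f" using assms(2) by (auto simp: image_image)
  then show ?thesis using assms(1) by (simp add: fin_index_def)
qed

lemma finite_range_pair:
  assumes "finite (range f)" "finite (range g)"
  shows "finite (range (\<lambda>u. (f u, g u)))"
  by (rule finite_subset[OF _ finite_cartesian_product[OF assms]]) auto

lemma fin_index_Int:
  assumes "fin_index L" "fin_index M"
  shows "fin_index (L \<inter> M)"
  by (rule fin_indexI[OF finite_range_pair[OF assms[unfolded fin_index_def]],
        where g = "\<lambda>p. fst p \<inter> snd p"]) (auto simp: lquot_def)

lemma fin_index_Diff:
  assumes "fin_index L" "fin_index M"
  shows "fin_index (L - M)"
  by (rule fin_indexI[OF finite_range_pair[OF assms[unfolded fin_index_def]],
        where g = "\<lambda>p. fst p - snd p"]) (auto simp: lquot_def)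

lemma fin_index_vimage_map:
  assumes "fin_index L"
  shows "fin_index {w. map h w \<in> L}"
proof (rule fin_indexI[where f = "\<lambda>u. lquot L (map h u)" and g = "\<lambda>K. {v. map h v \<in> K}"])
  show "finite (range (\<lambda>u. lquot L (map h u)))"
    by (rule finite_subset[OF _ assms[unfolded fin_index_def]]) auto
qed (auto simp: lquot_def)

text \<open>A subset construction: the state after \<open>u\<close> is the set of quotients of
  \<open>L\<close> reached along guessed preimages of \<open>u\<close>. The prefix \<open>w1\<close>
  serves projections: a projected coordinate with a long representation occupies leading columns
  that leave no trace in the projected word.\<close>

lemma fin_index_prefix_image_map:
  assumes "fin_index L"
  shows "fin_index {w. \<exists>w1 w2. w1 \<in> K \<and> map h w2 = w \<and> w1 @ w2 \<in> L}"
proof (rule fin_indexI[where f = "\<lambda>u. {lquot L (w1 @ u2) |w1 u2. w1 \<in> K \<and> map h u2 = u}"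
      and g = "\<lambda>\<K>. {v. \<exists>v2. map h v2 = v \<and> v2 \<in> \<Union>\<K>}"])
  show "finite (range (\<lambda>u. {lquot L (w1 @ u2) |w1 u2. w1 \<in> K \<and> map h u2 = u}))"
    by (rule finite_subset[where B = "Pow (range (lquot L))"])
      (use assms in \<open>auto simp: fin_index_def\<close>)
  fix u
  show "lquot {w. \<exists>w1 w2. w1 \<in> K \<and> map h w2 = w \<and> w1 @ w2 \<in> L} u =
    {v. \<exists>v2. map h v2 = v \<and> v2 \<in> \<Union>{lquot L (w1 @ u2) |w1 u2. w1 \<in> K \<and> map h u2 = u}}"
  proof (intro set_eqI iffI)
    fix v
    assume "v \<in> lquot {w. \<exists>w1 w2. w1 \<in> K \<and> map h w2 = w \<and> w1 @ w2 \<in> L} u"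
    then obtain w1 w2 where "w1 \<in> K" "map h w2 = u @ v" "w1 @ w2 \<in> L"
      by (auto simp: lquot_def)
    then obtain u2 v2 where "w2 = u2 @ v2" "map h u2 = u" "map h v2 = v"
      by (auto simp: map_eq_append_conv)
    moreover from this have "v2 \<in> lquot L (w1 @ u2)"
      using \<open>w1 @ w2 \<in> L\<close> by (simp add: lquot_def)
    ultimately show "v \<in> {v. \<exists>v2. map h v2 = v \<and> v2 \<in> \<Union>{lquot L (w1 @ u2) |w1 u2. w1 \<in> K \<and> map h u2 = u}}"
      using \<open>w1 \<in> K\<close> by blast
  next
    fix v
    assume "v \<in> {v. \<exists>v2. map h v2 = v \<and> v2 \<in> \<Union>{lquot L (w1 @ u2) |w1 u2. w1 \<in> K \<and> map h u2 = u}}"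
    then obtain v2 w1 u2 where "map h v2 = v" "w1 \<in> K" "map h u2 = u" "w1 @ u2 @ v2 \<in> L"
      by (auto simp: lquot_def)
    then have "w1 \<in> K \<and> map h (u2 @ v2) = u @ v \<and> w1 @ (u2 @ v2) \<in> L" by simp
    then show "v \<in> lquot {w. \<exists>w1 w2. w1 \<in> K \<and> map h w2 = w \<and> w1 @ w2 \<in> L} u"
      unfolding lquot_def by blast
  qed
qed

lemma foldl_state_in:
  assumes "q \<in> Q" "\<forall>q\<in>Q. \<forall>c. \<delta> q c \<in> Q"
  shows "foldl \<delta> q w \<in> Q"
  using assms by (induction w arbitrary: q) auto

text \<open>Myhill-Nerode: the quotients themselves are the states. As \<open>regular_lang\<close>
  asks for states in the natural numbers, they are numbered by an injection
  \<open>f\<close>.\<close>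

lemma regular_lang_iff_fin_index: "regular_lang L \<longleftrightarrow> fin_index L"
proof
  assume "regular_lang L"
  then obtain Q :: "nat set" and q0 \<delta> F where Q: "finite Q" "q0 \<in> Q" "\<forall>q\<in>Q. \<forall>c. \<delta> q c \<in> Q"
    and L: "L = {w. foldl \<delta> q0 w \<in> F}"
    unfolding regular_lang_def by blast
  show "fin_index L"
  proof (rule fin_indexI[where f = "foldl \<delta> q0" and g = "\<lambda>q. {v. foldl \<delta> q v \<in> F}"])
    show "finite (range (foldl \<delta> q0))"
      by (rule finite_subset[OF _ Q(1)]) (use foldl_state_in[OF Q(2,3)] in auto)
  qed (auto simp: lquot_def L)
next
  assume "fin_index L"
  then have fin: "finite (range (lquot L))" by (simp add: fin_index_def)
  then obtain f :: "'a list set \<Rightarrow> nat" where inj: "inj_on f (range (lquot L))"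
    using finite_imp_inj_to_nat_seg[OF fin] by auto
  define \<delta> where "\<delta> q c = f {v. c # v \<in> inv_into (range (lquot L)) f q}" for q c
  have step: "\<delta> (f (lquot L u)) c = f (lquot L (u @ [c]))" for u c
  proof -
    have "inv_into (range (lquot L)) f (f (lquot L u)) = lquot L u"
      using inj by (simp add: inv_into_f_f)
    then show ?thesis by (simp add: \<delta>_def lquot_def)
  qed
  have run: "foldl \<delta> (f (lquot L [])) w = f (lquot L w)" for w
    by (induction w rule: rev_induct) (auto simp: step)
  define F where "F = f ` {K \<in> range (lquot L). [] \<in> K}"
  have "f (lquot L w) \<in> F \<longleftrightarrow> w \<in> L" for w
  proof -
    have "f (lquot L w) \<in> F \<longleftrightarrow> lquot L w \<in> {K \<in> range (lquot L). [] \<in> K}"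
      unfolding F_def by (rule inj_on_image_mem_iff[OF inj]) auto
    then show ?thesis by (auto simp: lquot_def)
  qed
  then have "L = {w. foldl \<delta> (f (lquot L [])) w \<in> F}" by (simp add: run)
  moreover have "\<forall>q\<in>f ` range (lquot L). \<forall>c. \<delta> q c \<in> f ` range (lquot L)"
    using step by auto
  moreover have "F \<subseteq> f ` range (lquot L)" by (auto simp: F_def)
  ultimately show "regular_lang L"
    unfolding regular_lang_def
    using fin by (intro exI[of _ "f ` range (lquot L)"] exI[of _ "f (lquot L [])"] exI[of _ \<delta>]
        exI[of _ F]) auto
qed

section \<open>Encodings of tuples with arbitrary leading padding\<close>

definition padded :: "'b list \<Rightarrow> 'b option list \<Rightarrow> bool" where
  "padded r t \<longleftrightarrow> (\<exists>j. t = replicate j None @ map Some r)"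

lemma map_filter_padded: "padded r t \<Longrightarrow> List.map_filter id t = r"
  by (auto simp: padded_def map_filter_def o_def)

lemma padded_unique: "padded r t \<Longrightarrow> padded s t \<Longrightarrow> r = s"
  by (auto dest: map_filter_padded)

lemma padded_Cons_None: "padded r (None # t) \<Longrightarrow> padded r t"
proof -
  assume "padded r (None # t)"
  then obtain j where j: "None # t = replicate j None @ map Some r" by (auto simp: padded_def)
  then obtain i where "j = Suc i" by (cases j) auto
  with j show "padded r t" by (auto simp: padded_def)
qed

lemma padded_append_None: "padded r (replicate k None @ t) \<longleftrightarrow> padded r t"
proof
  show "padded r (replicate k None @ t) \<Longrightarrow> padded r t"
    by (induction k) (auto dest: padded_Cons_None)
  assume "padded r t"
  then obtain j where "t = replicate j None @ map Some r" by (auto simp: padded_def)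
  then have "replicate k None @ t = replicate (k + j) None @ map Some r"
    by (simp add: replicate_add)
  then show "padded r (replicate k None @ t)" unfolding padded_def by blast
qed

lemma padded_iff_nth:
  "padded r t \<longleftrightarrow> length r \<le> length t \<and>
     (\<forall>k<length t. t ! k = (if k < length t - length r then None
                            else Some (r ! (k - (length t - length r)))))"
  (is "_ \<longleftrightarrow> ?R")
proof
  assume ?R
  then have "t = replicate (length t - length r) None @ map Some r"
    by (intro nth_equalityI) (auto simp: nth_append)
  then show "padded r t" unfolding padded_def by blast
qed (auto simp: padded_def nth_append)

text \<open>Allowing an arbitrary number of leading padding columns makes the encodings stable under
  permuting, duplicating and dropping coordinates.\<close>
definition encodes :: "(nat \<Rightarrow> 'b list) \<Rightarrow> 'b option list list \<Rightarrow> nat list \<Rightarrow> bool" where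
  "encodes rep w ns \<longleftrightarrow> (\<forall>c\<in>set w. length c = length ns) \<and>
     (\<forall>i<length ns. padded (rep (ns ! i)) (map (\<lambda>c. c ! i) w))"

definition enc_lang :: "(nat \<Rightarrow> 'b list) \<Rightarrow> nat \<Rightarrow> (nat list \<Rightarrow> bool) \<Rightarrow> 'b option list list set" where
  "enc_lang rep d P = {w. \<exists>ns. length ns = d \<and> encodes rep w ns \<and> P ns}"

definition definable :: "(nat \<Rightarrow> 'b list) \<Rightarrow> nat \<Rightarrow> (nat list \<Rightarrow> bool) \<Rightarrow> bool" where
  "definable rep d P \<longleftrightarrow> fin_index (enc_lang rep d P)"

lemma length_rep_tuple:
  "length (rep_tuple rep ns) = Max (insert 0 (set (map (\<lambda>n. length (rep n)) ns)))"
  by (simp add: rep_tuple_def Let_def)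

lemma length_rep_le: "n \<in> set ns \<Longrightarrow> length (rep n) \<le> length (rep_tuple rep ns)"
  by (auto simp: length_rep_tuple intro!: Max_ge)

lemma rep_tuple_nth:
  assumes "k < length (rep_tuple rep ns)" "i < length ns"
  shows "rep_tuple rep ns ! k ! i =
    (if k < length (rep_tuple rep ns) - length (rep (ns ! i)) then None
     else Some (rep (ns ! i) ! (k - (length (rep_tuple rep ns) - length (rep (ns ! i))))))"
  using assms unfolding rep_tuple_def Let_def by auto

lemma length_rep_tuple_col: "c \<in> set (rep_tuple rep ns) \<Longrightarrow> length c = length ns"
  by (auto simp: rep_tuple_def Let_def)

lemma encodes_rep_tuple: "encodes rep (rep_tuple rep ns) ns"
  unfolding encodes_def padded_iff_nth
  using length_rep_tuple_col by (auto simp: length_rep_le rep_tuple_nth)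

text \<open>The longest representation is not padded, so it contributes a letter to the first
  column. This singles out the canonical word among all encodings of a tuple.\<close>

lemma rep_tuple_leading:
  "rep_tuple rep ns = [] \<or> hd (rep_tuple rep ns) \<noteq> replicate (length ns) None"
proof (cases "rep_tuple rep ns = []")
  case False
  define m where "m = length (rep_tuple rep ns)"
  have m0: "m > 0" using False by (simp add: m_def)
  have "m \<in> insert 0 (set (map (\<lambda>n. length (rep n)) ns))"
    unfolding m_def length_rep_tuple by (rule Max_in) auto
  then obtain i where i: "i < length ns" "length (rep (ns ! i)) = m"
    using m0 by (auto simp: in_set_conv_nth)
  have "rep_tuple rep ns ! 0 ! i \<noteq> None"
    using rep_tuple_nth[of 0 rep ns i] i m0 by (simp add: m_def)
  then have "hd (rep_tuple rep ns) ! i \<noteq> None" using False by (simp add: hd_conv_nth)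
  then show ?thesis using i(1) by (metis nth_replicate)
qed simp

lemma encodes_padding:
  "encodes rep (replicate j (replicate (length ns) None) @ w) ns \<longleftrightarrow> encodes rep w ns"
  unfolding encodes_def by (auto simp: padded_append_None)

lemma encodes_iff:
  "encodes rep w ns \<longleftrightarrow> (\<exists>j. w = replicate j (replicate (length ns) None) @ rep_tuple rep ns)"
proof
  assume e: "encodes rep w ns"
  define m where "m = length (rep_tuple rep ns)"
  have le: "length (rep (ns ! i)) \<le> length w" if "i < length ns" for i
    using e that unfolding encodes_def padded_iff_nth by auto
  have mle: "m \<le> length w"
    unfolding m_def length_rep_tuple using le by (auto simp: in_set_conv_nth)
  have lm: "length (rep (ns ! i)) \<le> m" if "i < length ns" for i
    using that by (simp add: m_def length_rep_le)
  have val: "w ! k ! i = (if k < length w - length (rep (ns ! i)) then None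
                            else Some (rep (ns ! i) ! (k - (length w - length (rep (ns ! i))))))"
    if "i < length ns" "k < length w" for i k
    using e that unfolding encodes_def padded_iff_nth by auto
  have "w = replicate (length w - m) (replicate (length ns) None) @ rep_tuple rep ns" (is "w = ?u")
  proof (rule nth_equalityI)
    show "length w = length ?u" using mle by (simp add: m_def)
    fix k assume k: "k < length w"
    have len: "length (?u ! k) = length ns" "length (w ! k) = length ns"
      using e k mle length_rep_tuple_col[of "rep_tuple rep ns ! (k - (length w - m))" rep ns]
      by (auto simp: nth_append m_def encodes_def)
    show "w ! k = ?u ! k"
    proof (rule nth_equalityI)
      fix i assume "i < length (w ! k)"
      then have i: "i < length ns" using len by simp
      show "w ! k ! i = ?u ! k ! i"
      proof (cases "k < length w - m")
        case True
        then show ?thesis using val[OF i k] lm[OF i] i by (auto simp: nth_append)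
      next
        case False
        then have km: "k - (length w - m) < length (rep_tuple rep ns)" using k mle by (simp add: m_def)
        show ?thesis
          using False val[OF i k] rep_tuple_nth[OF km i] lm[OF i] mle k
          by (auto simp: nth_append m_def[symmetric])
      qed
    qed (simp add: len)
  qed
  then show "\<exists>j. w = replicate j (replicate (length ns) None) @ rep_tuple rep ns" by blast
qed (auto simp: encodes_padding encodes_rep_tuple)

lemma dropWhile_rep_tuple:
  "dropWhile (\<lambda>c. c = replicate (length ns) None)
     (replicate j (replicate (length ns) None) @ rep_tuple rep ns) = rep_tuple rep ns"
proof -
  have "dropWhile (\<lambda>c. c = replicate (length ns) None) (rep_tuple rep ns) = rep_tuple rep ns"
    using rep_tuple_leading[of rep ns] by (cases "rep_tuple rep ns") auto
  then show ?thesis by (subst dropWhile_append2) auto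
qed

text \<open>Leading padding columns are stripped before testing membership. The state is
  \<open>None\<close> as long as only such columns have been read, and a quotient of
  \<open>L\<close> afterwards.\<close>

lemma definable_if_recognizable:
  fixes rep :: "nat \<Rightarrow> 'b list"
  assumes "recognizable rep d {ns. length ns = d \<and> P ns}"
  shows "definable rep d P"
proof -
  define L where "L = rep_tuple rep ` {ns. length ns = d \<and> P ns}"
  let ?N = "replicate d (None :: 'b option)"
  let ?D = "dropWhile (\<lambda>c. c = ?N)"
  have fin: "finite (range (lquot L))"
    using assms by (simp add: recognizable_def regular_lang_iff_fin_index L_def fin_index_def)
  have "enc_lang rep d P = {w. ?D w \<in> L}"
  proof (intro set_eqI iffI)
    fix w assume "w \<in> enc_lang rep d P"
    then show "w \<in> {w. ?D w \<in> L}"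
      by (auto simp: enc_lang_def encodes_iff L_def dropWhile_rep_tuple)
  next
    fix w assume "w \<in> {w. ?D w \<in> L}"
    then obtain ns where ns: "length ns = d" "P ns" "?D w = rep_tuple rep ns"
      by (auto simp: L_def)
    have "takeWhile (\<lambda>c. c = ?N) w = replicate (length (takeWhile (\<lambda>c. c = ?N) w)) ?N"
      by (rule replicate_eqI) (auto dest: set_takeWhileD)
    then have "w = replicate (length (takeWhile (\<lambda>c. c = ?N) w)) ?N @ rep_tuple rep ns"
      using ns(3) takeWhile_dropWhile_id[of "\<lambda>c. c = ?N" w] by metis
    then show "w \<in> enc_lang rep d P"
      using ns unfolding enc_lang_def encodes_iff by blast
  qed
  moreover have "fin_index {w. ?D w \<in> L}"
  proof (rule fin_indexI[where f = "\<lambda>u. if ?D u = [] then None else Some (lquot L (?D u))"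
        and g = "\<lambda>s. case s of None \<Rightarrow> {v. ?D v \<in> L} | Some K \<Rightarrow> K"])
    show "finite (range (\<lambda>u. if ?D u = [] then None else Some (lquot L (?D u))))"
      by (rule finite_subset[where B = "insert None (Some ` range (lquot L))"]) (use fin in auto)
    fix u
    have "?D (u @ v) = (if ?D u = [] then ?D v else ?D u @ v)" for v
      by (simp add: dropWhile_append)
    then show "lquot {w. ?D w \<in> L} u =
      (case if ?D u = [] then None else Some (lquot L (?D u)) of
         None \<Rightarrow> {v. ?D v \<in> L} | Some K \<Rightarrow> K)"
      by (auto simp: lquot_def)
  qed
  ultimately show ?thesis by (simp add: definable_def)
qed

text \<open>The canonical words are exactly the encodings that do not start with a padding column,
  and this restriction has finite index.\<close>

lemma recognizable_if_definable:
  fixes rep :: "nat \<Rightarrow> 'b list"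
  assumes "definable rep d P"
  shows "recognizable rep d {ns. length ns = d \<and> P ns}"
proof -
  let ?N = "replicate d (None :: 'b option)"
  have "rep_tuple rep ` {ns. length ns = d \<and> P ns} =
    enc_lang rep d P \<inter> {w. w = [] \<or> hd w \<noteq> ?N}" (is "?A = ?B")
  proof (intro set_eqI iffI)
    fix w assume "w \<in> ?A"
    then show "w \<in> ?B" using rep_tuple_leading[of rep] encodes_rep_tuple[of rep]
      by (auto simp: enc_lang_def)
  next
    fix w assume w: "w \<in> ?B"
    then obtain ns j where ns: "length ns = d" "P ns" "w = replicate j ?N @ rep_tuple rep ns"
      by (auto simp: enc_lang_def encodes_iff)
    then have "j = 0" using w by (cases j) auto
    then show "w \<in> ?A" using ns by auto
  qed
  moreover have "fin_index {w. w = [] \<or> hd w \<noteq> ?N}"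
    by (rule fin_indexI[where f = "\<lambda>u. (u = [], hd u = ?N)"
          and g = "\<lambda>(e, n). {v. if e then v = [] \<or> hd v \<noteq> ?N else \<not> n}"])
      (auto simp: lquot_def hd_append)
  ultimately show ?thesis
    using assms by (simp add: recognizable_def regular_lang_iff_fin_index definable_def
        fin_index_Int subset_eq)
qed

lemma definable_cong:
  assumes "definable rep d P" "\<And>ns. length ns = d \<Longrightarrow> P ns \<longleftrightarrow> Q ns"
  shows "definable rep d Q"
proof -
  have "enc_lang rep d P = enc_lang rep d Q" using assms(2) by (auto simp: enc_lang_def)
  then show ?thesis using assms(1) by (simp add: definable_def)
qed

text \<open>Quantification deletes the first track. An encoding of \<open>ns\<close> can be too
  short to hold \<open>rep n\<close>, so columns that carry letters on the deleted track only may be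
  added in front.\<close>

lemma definable_ex:
  assumes "definable rep (Suc d) (\<lambda>ns. P (hd ns) (tl ns))"
  shows "definable rep d (\<lambda>ns. \<exists>n. P n ns)"
proof -
  let ?Q = "\<lambda>ns. P (hd ns) (tl ns)"
  let ?K = "{w1. \<forall>c\<in>set w1. tl c = replicate d (None :: 'a option)}"
  have "enc_lang rep d (\<lambda>ns. \<exists>n. P n ns) =
    {w. \<exists>w1 w2. w1 \<in> ?K \<and> map tl w2 = w \<and> w1 @ w2 \<in> enc_lang rep (Suc d) ?Q}" (is "?A = ?B")
  proof (intro set_eqI iffI)
    fix w assume "w \<in> ?A"
    then obtain ns n where ns: "length ns = d" "encodes rep w ns" "P n ns"
      by (auto simp: enc_lang_def)
    \<comment> \<open>Adding \<open>length (rep n)\<close> columns makes room for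
      \<open>rep n\<close> whatever the length of \<open>w\<close> is; the track of \<open>n\<close>
      then needs \<open>length w\<close> padding symbols.\<close>
    define t where "t = replicate (length w) None @ map Some (rep n)"
    define r where "r = length (rep n)"
    define u where "u = replicate r (replicate d None) @ w"
    define w' where "w' = map2 (#) t u"
    have len: "length t = length u" by (simp add: t_def u_def r_def)
    have tl': "map tl w' = u"
      unfolding w'_def using len by (intro nth_equalityI) auto
    have hd': "map (\<lambda>c. c ! 0) w' = t"
      unfolding w'_def using len by (intro nth_equalityI) auto
    have u: "encodes rep u ns" using ns encodes_padding[of rep r ns w] by (simp add: u_def)
    have "map (\<lambda>c. c ! Suc i) w' = map (\<lambda>c. c ! i) u" for i
      unfolding w'_def using len by (intro nth_equalityI) auto
    then have tracks: "padded (rep ((n # ns) ! i)) (map (\<lambda>c. c ! i) w')" if "i < Suc d" for i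
      using u ns(1) hd' that by (cases i) (auto simp: encodes_def padded_def t_def)
    have cols: "length c = Suc d" if "c \<in> set w'" for c
      using that u ns(1) unfolding w'_def encodes_def by (auto dest: set_zip_rightD)
    have "encodes rep w' (n # ns)"
      using tracks cols ns(1) by (simp add: encodes_def)
    then have "w' \<in> enc_lang rep (Suc d) ?Q"
      using ns unfolding enc_lang_def by (auto intro!: exI[of _ "n # ns"])
    moreover have "map tl (drop r w') = w" by (simp add: drop_map[symmetric] tl' u_def)
    moreover have "map tl (take r w') = replicate r (replicate d None)"
      by (simp add: take_map[symmetric] tl' u_def)
    then have "tl ` set (take r w') \<subseteq> {replicate d None}"
      by (metis set_map set_replicate_conv_if empty_subsetI order_refl)
    then have "take r w' \<in> ?K" by blast
    ultimately have "take r w' \<in> ?K \<and> map tl (drop r w') = w \<and>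
        take r w' @ drop r w' \<in> enc_lang rep (Suc d) ?Q"
      by (simp only: append_take_drop_id)
    then show "w \<in> ?B" by blast
  next
    fix w assume "w \<in> ?B"
    then obtain w1 w2 ms where w: "w1 \<in> ?K" "map tl w2 = w" "length ms = Suc d"
      "encodes rep (w1 @ w2) ms" "?Q ms"
      by (auto simp: enc_lang_def)
    then obtain n ns where ms: "ms = n # ns" "length ns = d" by (cases ms) auto
    have len: "length c = Suc d" if "c \<in> set w1 \<union> set w2" for c
      using w that by (auto simp: encodes_def)
    have nthtl: "c ! Suc i = tl c ! i" if "c \<in> set w1 \<union> set w2" "i < d" for c i
      using len[OF that(1)] by (cases c) auto
    have "padded (rep (ns ! i)) (map (\<lambda>c. c ! i) w)" if i: "i < d" for i
    proof -
      have "padded (rep (ms ! Suc i)) (map (\<lambda>c. c ! Suc i) (w1 @ w2))"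
        using w i by (simp add: encodes_def)
      moreover have "map (\<lambda>c. c ! Suc i) w1 = replicate (length w1) None"
        using nthtl[OF _ i] w(1) i by (intro replicate_eqI) auto
      moreover have "map (\<lambda>c. c ! Suc i) w2 = map (\<lambda>c. c ! i) w"
        using nthtl[OF _ i] w(2) by auto
      ultimately show ?thesis by (simp add: padded_append_None ms)
    qed
    then have "encodes rep w ns" using ms len w(2) by (auto simp: encodes_def)
    then show "w \<in> ?A" using w(5) ms unfolding enc_lang_def by auto
  qed
  then show ?thesis
    using fin_index_prefix_image_map[of "enc_lang rep (Suc d) ?Q" ?K tl] assms
    by (simp add: definable_def)
qed

section \<open>Closure of the definable relations under first-order operations\<close>

locale addable_system =
  fixes rep :: "nat \<Rightarrow> 'b::finite list"
  assumes inj_rep: "inj rep" and add: "addable rep"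
begin

lemma encodes_unique:
  assumes "encodes rep w ns" "encodes rep w ms" "length ns = length ms"
  shows "ns = ms"
proof (rule nth_equalityI)
  fix i assume "i < length ns"
  then have "rep (ns ! i) = rep (ms ! i)"
    using assms by (intro padded_unique[of _ "map (\<lambda>c. c ! i) w"]) (auto simp: encodes_def)
  then show "ns ! i = ms ! i" using inj_rep by (simp add: inj_eq)
qed (rule assms)

lemma definable_add: "definable rep 3 (\<lambda>ns. ns ! 0 + ns ! 1 = ns ! 2)"
proof (rule definable_if_recognizable)
  have "{ns. length ns = 3 \<and> ns ! 0 + ns ! 1 = ns ! 2} = {[x, y, x + y] |x y :: nat. True}"
    by (auto simp: length_Suc_conv numeral_3_eq_3)
  then show "recognizable rep 3 {ns. length ns = 3 \<and> ns ! 0 + ns ! 1 = ns ! 2}"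
    using add unfolding addable_def by (simp only:)
qed

text \<open>Regularity of the language of all representations is extracted from addability: every
  number is a sum, so the projection of the graph of addition to its last coordinate is
  everything.\<close>

lemma definable_True1: "definable rep 1 (\<lambda>ns. True)"
proof -
  have "definable rep 2 (\<lambda>ns. \<exists>n. n + ns ! 0 = ns ! 1)"
    by (rule definable_ex, rule definable_cong[OF definable_add[unfolded numeral_3_eq_3]
          , folded numeral_2_eq_2])
      (auto simp: length_Suc_conv numeral_2_eq_2)
  then have "definable rep 1 (\<lambda>ns. \<exists>m n. n + m = ns ! 0)"
    by (intro definable_ex[where P = "\<lambda>m ns. \<exists>n. n + m = ns ! 0"], unfold numeral_2_eq_2 One_nat_def)
      (erule definable_cong, auto simp: length_Suc_conv)
  then show ?thesis by (rule definable_cong) presburger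
qed

text \<open>Validity of an encoding can be tested on each track separately, apart from the
  requirement that all columns have length \<open>d\<close>.\<close>

lemma definable_True: "definable rep d (\<lambda>ns. True)"
proof -
  have cols: "fin_index {w. \<forall>c\<in>set w. length c = d}"
    by (rule fin_indexI[where f = "\<lambda>u. \<forall>c\<in>set u. length c = d"
          and g = "\<lambda>b. if b then {w. \<forall>c\<in>set w. length c = d} else {}"]) (auto simp: lquot_def)
  define E where "E k = {w. (\<forall>c\<in>set w. length c = d) \<and>
    (\<forall>i<k. map (\<lambda>c. [c ! i]) w \<in> enc_lang rep 1 (\<lambda>_. True))}" for k
  have "fin_index (E k)" for k
  proof (induction k)
    case 0
    then show ?case using cols by (simp add: E_def)
  next
    case (Suc k)
    have "E (Suc k) = E k \<inter> {w. map (\<lambda>c. [c ! k]) w \<in> enc_lang rep 1 (\<lambda>_. True)}"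
      by (auto simp: E_def less_Suc_eq)
    then show ?case using Suc fin_index_vimage_map[OF definable_True1[unfolded definable_def]]
      by (metis fin_index_Int)
  qed
  moreover have "E d = enc_lang rep d (\<lambda>_. True)"
  proof (intro set_eqI iffI)
    fix w assume w: "w \<in> E d"
    have "\<exists>n. padded (rep n) (map (\<lambda>c. c ! i) w)" if "i < d" for i
    proof -
      have "map (\<lambda>c. [c ! i]) w \<in> enc_lang rep 1 (\<lambda>_. True)" using w that by (simp add: E_def)
      then obtain ns where "length ns = 1" "encodes rep (map (\<lambda>c. [c ! i]) w) ns"
        by (auto simp: enc_lang_def)
      then show ?thesis by (auto simp: encodes_def o_def)
    qed
    then obtain f where "\<And>i. i < d \<Longrightarrow> padded (rep (f i)) (map (\<lambda>c. c ! i) w)" by metis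
    then have "encodes rep w (map f [0..<d])" using w by (auto simp: encodes_def E_def)
    then show "w \<in> enc_lang rep d (\<lambda>_. True)" unfolding enc_lang_def
      by (auto intro!: exI[of _ "map f [0..<d]"])
  next
    fix w assume "w \<in> enc_lang rep d (\<lambda>_. True)"
    then obtain ns where ns: "length ns = d" "encodes rep w ns" by (auto simp: enc_lang_def)
    have "encodes rep (map (\<lambda>c. [c ! i]) w) [ns ! i]" if "i < d" for i
      using ns that by (auto simp: encodes_def o_def)
    then show "w \<in> E d" using ns unfolding E_def enc_lang_def
      by (auto simp: encodes_def intro!: exI[of _ "[ns ! i]" for i])
  qed
  ultimately show ?thesis unfolding definable_def by metis
qed

text \<open>Since \<open>rep\<close> is injective, a word encodes at most one tuple of a given
  length. Boolean operations on predicates therefore become Boolean operations on languages.\<close>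

lemma enc_lang_iff:
  assumes "length ns = d" "encodes rep w ns"
  shows "w \<in> enc_lang rep d P \<longleftrightarrow> P ns"
proof
  assume "w \<in> enc_lang rep d P"
  then obtain ms where ms: "length ms = d" "encodes rep w ms" "P ms" by (auto simp: enc_lang_def)
  have "ns = ms" by (rule encodes_unique[OF assms(2) ms(2)]) (simp add: assms(1) ms(1))
  then show "P ns" using ms(3) by simp
next
  assume "P ns"
  then show "w \<in> enc_lang rep d P" using assms by (auto simp: enc_lang_def)
qed

lemma definable_conj:
  assumes "definable rep d P" "definable rep d Q"
  shows "definable rep d (\<lambda>ns. P ns \<and> Q ns)"
proof -
  have "w \<in> enc_lang rep d (\<lambda>ns. P ns \<and> Q ns) \<longleftrightarrow> w \<in> enc_lang rep d P \<inter> enc_lang rep d Q" for w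
  proof (cases "\<exists>ns. length ns = d \<and> encodes rep w ns")
    case True
    then obtain ns where "length ns = d" "encodes rep w ns" by blast
    note eq = enc_lang_iff[OF this]
    show ?thesis by (simp add: eq)
  qed (auto simp: enc_lang_def)
  then have "enc_lang rep d (\<lambda>ns. P ns \<and> Q ns) = enc_lang rep d P \<inter> enc_lang rep d Q" by blast
  then show ?thesis using assms by (simp add: definable_def fin_index_Int)
qed

text \<open>The complement is taken within the valid encodings, whose regularity is
  \<open>definable_True\<close>.\<close>

lemma definable_not:
  assumes "definable rep d P"
  shows "definable rep d (\<lambda>ns. \<not> P ns)"
proof -
  have "w \<in> enc_lang rep d (\<lambda>ns. \<not> P ns) \<longleftrightarrow> w \<in> enc_lang rep d (\<lambda>_. True) - enc_lang rep d P" for w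
  proof (cases "\<exists>ns. length ns = d \<and> encodes rep w ns")
    case True
    then obtain ns where "length ns = d" "encodes rep w ns" by blast
    note eq = enc_lang_iff[OF this]
    show ?thesis by (simp add: eq)
  qed (auto simp: enc_lang_def)
  then have "enc_lang rep d (\<lambda>ns. \<not> P ns) = enc_lang rep d (\<lambda>_. True) - enc_lang rep d P" by blast
  then show ?thesis using assms definable_True by (simp add: definable_def fin_index_Diff)
qed

lemma definable_disj:
  assumes "definable rep d P" "definable rep d Q"
  shows "definable rep d (\<lambda>ns. P ns \<or> Q ns)"
proof -
  have "definable rep d (\<lambda>ns. \<not> (\<not> P ns \<and> \<not> Q ns))"
    using assms by (intro definable_not definable_conj)
  then show ?thesis by simp
qed

lemma definable_ball:
  assumes "finite S" "\<And>s. s \<in> S \<Longrightarrow> definable rep d (P s)"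
  shows "definable rep d (\<lambda>ns. \<forall>s\<in>S. P s ns)"
  using assms
proof (induction S rule: finite_induct)
  case (insert s S)
  then have "definable rep d (\<lambda>ns. P s ns \<and> (\<forall>s\<in>S. P s ns))" by (intro definable_conj) auto
  then show ?case by simp
qed (simp add: definable_True)

lemma definable_bex:
  assumes "finite S" "\<And>s. s \<in> S \<Longrightarrow> definable rep d (P s)"
  shows "definable rep d (\<lambda>ns. \<exists>s\<in>S. P s ns)"
proof -
  have "definable rep d (\<lambda>ns. \<not> (\<forall>s\<in>S. \<not> P s ns))"
    using assms by (intro definable_not definable_ball)
  then show ?thesis by simp
qed

lemma definable_reindex:
  assumes "definable rep d P" "\<And>i. i < d \<Longrightarrow> f i < d'"
  shows "definable rep d' (\<lambda>ns. P (map (\<lambda>i. ns ! f i) [0..<d]))"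
proof -
  let ?h = "\<lambda>c :: 'b option list. map (\<lambda>i. c ! f i) [0..<d]"
  have enc: "encodes rep (map ?h w) (map (\<lambda>i. ns ! f i) [0..<d])"
    if "length ns = d'" "encodes rep w ns" for w ns
    using that assms(2) by (auto simp: encodes_def o_def)
  have "w \<in> enc_lang rep d' (\<lambda>ns. P (map (\<lambda>i. ns ! f i) [0..<d])) \<longleftrightarrow>
    w \<in> {w. map ?h w \<in> enc_lang rep d P} \<inter> enc_lang rep d' (\<lambda>_. True)" for w
  proof (cases "\<exists>ns. length ns = d' \<and> encodes rep w ns")
    case True
    then obtain ns where ns: "length ns = d'" "encodes rep w ns" by blast
    have "length (map (\<lambda>i. ns ! f i) [0..<d]) = d" by simp
    note eq = enc_lang_iff[OF this enc[OF ns]] enc_lang_iff[OF ns]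
    show ?thesis by (simp only: eq Int_iff mem_Collect_eq simp_thms)
  qed (auto simp: enc_lang_def)
  then have "enc_lang rep d' (\<lambda>ns. P (map (\<lambda>i. ns ! f i) [0..<d])) =
    {w. map ?h w \<in> enc_lang rep d P} \<inter> enc_lang rep d' (\<lambda>_. True)" by blast
  moreover have "fin_index ({w. map ?h w \<in> enc_lang rep d P} \<inter> enc_lang rep d' (\<lambda>_. True))"
    using assms(1) definable_True[of d'] unfolding definable_def
    by (intro fin_index_Int fin_index_vimage_map)
  ultimately show ?thesis unfolding definable_def by (simp only:)
qed

end

subsection \<open>The winning shift of an orbit closure\<close>

lemma shift_funpow: "(shift ^^ k) x = (\<lambda>n. x (k + n))"
  by (induction k arbitrary: x) (auto simp: shift_def fun_eq_iff)

text \<open>A basic open set of the product topology restricts finitely many coordinates, so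
  membership in the closure can be tested on prefixes.\<close>

lemma generated_subshift_iff:
  "z \<in> generated_subshift x \<longleftrightarrow> (\<forall>n. map z [0..<n] \<in> factors x n)"
proof
  assume z: "z \<in> generated_subshift x"
  show "\<forall>n. map z [0..<n] \<in> factors x n"
  proof
    fix n
    let ?T = "Pi\<^sub>E UNIV (\<lambda>k. if k < n then {z k} else UNIV)"
    have "openin seq_topology ?T"
      unfolding seq_topology_def
    proof (subst openin_PiE_gen, rule disjI2, intro conjI ballI)
      have "{i. (if i < n then {z i} else UNIV) \<noteq> UNIV} \<subseteq> {..<n}" by auto
      then show "finite {i \<in> UNIV. (if i < n then {z i} else UNIV) \<noteq> topspace (discrete_topology UNIV)}"
        by (simp add: finite_subset)
    qed auto
    moreover have "z \<in> ?T" by (auto simp: PiE_def)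
    ultimately obtain k where "(shift ^^ k) x \<in> ?T"
      using z by (auto simp: generated_subshift_def in_closure_of)
    then have "\<forall>j<n. x (k + j) = z j" by (auto simp: shift_funpow PiE_def Pi_def split: if_splits)
    then have "map z [0..<n] = map (\<lambda>j. x (k + j)) [0..<n]" by simp
    then show "map z [0..<n] \<in> factors x n" by (auto simp: factors_def)
  qed
next
  assume z: "\<forall>n. map z [0..<n] \<in> factors x n"
  show "z \<in> generated_subshift x"
    unfolding generated_subshift_def in_closure_of
  proof (intro conjI allI impI)
    show "z \<in> topspace seq_topology" by (simp add: seq_topology_def)
    fix T assume "z \<in> T \<and> openin seq_topology T"
    then obtain U where U: "finite {i. U i \<noteq> (UNIV :: 'a set)}" "z \<in> Pi\<^sub>E UNIV U" "Pi\<^sub>E UNIV U \<subseteq> T"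
      unfolding seq_topology_def openin_product_topology_alt by force
    then obtain n where n: "\<And>i. U i \<noteq> UNIV \<Longrightarrow> i < n"
      using finite_nat_set_iff_bounded by auto
    from z obtain k where k: "map z [0..<n] = map (\<lambda>j. x (k + j)) [0..<n]"
      by (auto simp: factors_def)
    have "x (k + i) \<in> U i" for i
    proof (cases "i < n")
      case True
      then have "z i = x (k + i)" using k by simp
      then show ?thesis using U(2) by (metis PiE_mem UNIV_I)
    next
      case False
      then show ?thesis using n by blast
    qed
    then have "(shift ^^ k) x \<in> Pi\<^sub>E UNIV U" by (simp add: shift_funpow PiE_iff)
    then show "\<exists>y. y \<in> {(shift ^^ k) x |k. True} \<and> y \<in> T" using U(3) by blast
  qed
qed

section \<open>The game continued from a history\<close>

definition prepend :: "'a list \<Rightarrow> (nat \<Rightarrow> 'a) \<Rightarrow> nat \<Rightarrow> 'a" where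
  "prepend h b n = (if n < length h then h ! n else b (n - length h))"

lemma prepend_snoc: "prepend (h @ [a]) b = prepend h (case_nat a b)"
proof
  fix n
  consider "n < length h" | "n = length h" | k where "n = Suc (length h + k)"
    by (metis less_imp_Suc_add linorder_neqE_nat)
  then show "prepend (h @ [a]) b n = prepend h (case_nat a b) n"
    by cases (auto simp: prepend_def nth_append)
qed

lemma prepend_Nil [simp]: "prepend [] b = b"
  by (simp add: prepend_def fun_eq_iff)

definition wins :: "(nat \<Rightarrow> 'a::finite) set \<Rightarrow> (nat \<Rightarrow> nat) \<Rightarrow> 'a list \<Rightarrow> bool" where
  "wins X \<alpha> h \<longleftrightarrow>
     (\<exists>\<sigma> :: 'a list \<Rightarrow> 'a set.
        (\<forall>g. card (\<sigma> g) = \<alpha> (length h + length g) + 1) \<and>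
        (\<forall>b. (\<forall>j. b j \<in> \<sigma> (map b [0..<j])) \<longrightarrow> prepend h b \<in> X))"

lemma winning_shift_iff: "\<alpha> \<in> winning_shift X \<longleftrightarrow> wins X \<alpha> []"
proof -
  have "\<alpha> j < CARD('a)" if "\<forall>g. card ((\<sigma> :: 'a list \<Rightarrow> 'a set) g) = \<alpha> (length g) + 1" for \<sigma> j
  proof -
    have "card (\<sigma> (replicate j undefined)) \<le> CARD('a)" by (intro card_mono) auto
    then show ?thesis using that by simp
  qed
  then show ?thesis unfolding winning_shift_def wins_def by auto
qed

lemma map_case_nat_upt: "map (case_nat a b) [0..<Suc j] = a # map b [0..<j]"
  by (simp add: upt_conv_Cons map_Suc_upt[symmetric] del: upt_Suc)

text \<open>One round of the game. A strategy restricts to strategies after each letter of its first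
  set; conversely, strategies chosen for the single letters are glued together.\<close>

lemma wins_unfold:
  "wins X \<alpha> h \<longleftrightarrow> (\<exists>A. card A = \<alpha> (length h) + 1 \<and> (\<forall>a\<in>A. wins X \<alpha> (h @ [a])))"
proof
  assume "wins X \<alpha> h"
  then obtain \<sigma> where card: "\<And>g. card (\<sigma> g) = \<alpha> (length h + length g) + 1"
    and win: "\<And>b. (\<And>j. b j \<in> \<sigma> (map b [0..<j])) \<Longrightarrow> prepend h b \<in> X"
    unfolding wins_def by blast
  have "wins X \<alpha> (h @ [a])" if a: "a \<in> \<sigma> []" for a
    unfolding wins_def
  proof (intro exI[of _ "\<lambda>g. \<sigma> (a # g)"] conjI allI impI)
    show "card (\<sigma> (a # g)) = \<alpha> (length (h @ [a]) + length g) + 1" for g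
      using card[of "a # g"] by simp
    fix b assume b: "\<forall>j. b j \<in> \<sigma> (a # map b [0..<j])"
    have "case_nat a b j \<in> \<sigma> (map (case_nat a b) [0..<j])" for j
      using a b by (cases j) (auto simp: map_case_nat_upt simp del: upt_Suc)
    from win[OF this] show "prepend (h @ [a]) b \<in> X" by (simp add: prepend_snoc)
  qed
  then show "\<exists>A. card A = \<alpha> (length h) + 1 \<and> (\<forall>a\<in>A. wins X \<alpha> (h @ [a]))"
    using card[of "[]"] by auto
next
  assume "\<exists>A. card A = \<alpha> (length h) + 1 \<and> (\<forall>a\<in>A. wins X \<alpha> (h @ [a]))"
  then obtain A where A: "card A = \<alpha> (length h) + 1" "\<And>a. a \<in> A \<Longrightarrow> wins X \<alpha> (h @ [a])" by blast
  have "\<forall>a\<in>A. \<exists>\<sigma>. (\<forall>g. card (\<sigma> g) = \<alpha> (length (h @ [a]) + length g) + 1) \<and>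
      (\<forall>b. (\<forall>j. b j \<in> \<sigma> (map b [0..<j])) \<longrightarrow> prepend (h @ [a]) b \<in> X)"
    using A(2) unfolding wins_def by blast
  from bchoice[OF this] obtain \<tau> where \<tau>: "\<And>a g. a \<in> A \<Longrightarrow>
      card (\<tau> a g) = \<alpha> (length (h @ [a]) + length g) + 1"
    "\<And>a b. a \<in> A \<Longrightarrow> (\<And>j. b j \<in> \<tau> a (map b [0..<j])) \<Longrightarrow> prepend (h @ [a]) b \<in> X"
    by blast
  \<comment> \<open>A strategy needs sets of the right size even after histories that cannot occur.
    There the strategy for \<open>a0\<close> is copied.\<close>
  obtain a0 where a0: "a0 \<in> A" using A(1) by (metis Suc_eq_plus1 card.empty ex_in_conv nat.distinct(1))
  define \<sigma> where "\<sigma> g = (case g of [] \<Rightarrow> A | a # g' \<Rightarrow> \<tau> (if a \<in> A then a else a0) g')" for g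
  show "wins X \<alpha> h"
    unfolding wins_def
  proof (intro exI[of _ \<sigma>] conjI allI impI)
    show "card (\<sigma> g) = \<alpha> (length h + length g) + 1" for g
      using A(1) \<tau>(1) a0 by (auto simp: \<sigma>_def split: list.split)
    fix b assume b: "\<forall>j. b j \<in> \<sigma> (map b [0..<j])"
    define c where "c j = b (Suc j)" for j
    have bc: "b = case_nat (b 0) c" by (auto simp: c_def fun_eq_iff split: nat.split)
    have b0: "b 0 \<in> A" using spec[OF b, of 0] by (simp add: \<sigma>_def)
    have "c j \<in> \<tau> (b 0) (map c [0..<j])" for j
    proof -
      have "map b [0..<Suc j] = b 0 # map c [0..<j]" by (subst bc) (rule map_case_nat_upt)
      then show ?thesis using spec[OF b, of "Suc j"] b0 by (simp add: \<sigma>_def c_def del: upt_Suc)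
    qed
    from \<tau>(2)[OF b0 this] show "prepend h b \<in> X" by (simp add: prepend_snoc bc[symmetric])
  qed
qed

text \<open>Alice's sets have at least one element, so Bob can complete a play against her strategy;
  \<open>p\<close> lists the histories of such a play.\<close>

lemma wins_nonempty:
  assumes "wins X \<alpha> h"
  shows "\<exists>b. prepend h b \<in> X"
proof -
  obtain \<sigma> where card: "\<And>g. card (\<sigma> g) = \<alpha> (length h + length g) + 1"
    and win: "\<And>b. (\<And>j. b j \<in> \<sigma> (map b [0..<j])) \<Longrightarrow> prepend h b \<in> X"
    using assms unfolding wins_def by blast
  define p where "p = rec_nat [] (\<lambda>_ g. g @ [SOME a. a \<in> \<sigma> g])"
  have p: "p 0 = []" "p (Suc n) = p n @ [SOME a. a \<in> \<sigma> (p n)]" for n by (simp_all add: p_def)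
  define b where "b n = (SOME a. a \<in> \<sigma> (p n))" for n
  have map: "map b [0..<n] = p n" for n by (induction n) (auto simp: p b_def)
  have "\<sigma> g \<noteq> {}" for g using card[of g] by auto
  then have "b j \<in> \<sigma> (map b [0..<j])" for j unfolding map by (simp add: b_def some_in_eq)
  from win[OF this] show ?thesis by blast
qed

abbreviation factor_at :: "(nat \<Rightarrow> 'a) \<Rightarrow> nat \<Rightarrow> nat \<Rightarrow> 'a list" where
  "factor_at x i n \<equiv> map (\<lambda>j. x (i + j)) [0..<n]"

lemma wins_imp_factor:
  assumes "wins (generated_subshift x) \<alpha> h"
  obtains i where "h = factor_at x i (length h)"
proof -
  obtain b where "prepend h b \<in> generated_subshift x" using wins_nonempty[OF assms] by blast
  then have "map (prepend h b) [0..<length h] \<in> factors x (length h)"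
    by (simp add: generated_subshift_iff)
  moreover have "map (prepend h b) [0..<length h] = h"
    by (rule nth_equalityI) (auto simp: prepend_def)
  ultimately show ?thesis using that by (auto simp: factors_def)
qed

text \<open>Winning histories are factors of \<open>x\<close>. Quantifying over words thus becomes
  quantifying over positions in \<open>x\<close>, which are numbers.\<close>

lemma ex_wins_factor_iff:
  "(\<exists>g. length g = n \<and> P g \<and> wins (generated_subshift x) \<alpha> g) \<longleftrightarrow>
   (\<exists>k. P (factor_at x k n) \<and> wins (generated_subshift x) \<alpha> (factor_at x k n))"
proof
  assume "\<exists>g. length g = n \<and> P g \<and> wins (generated_subshift x) \<alpha> g"
  then obtain g where g: "length g = n" "P g" "wins (generated_subshift x) \<alpha> g" by blast
  obtain k where "g = factor_at x k (length g)" using wins_imp_factor[OF g(3)] by blast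
  with g show "\<exists>k. P (factor_at x k n) \<and> wins (generated_subshift x) \<alpha> (factor_at x k n)" by metis
next
  assume "\<exists>k. P (factor_at x k n) \<and> wins (generated_subshift x) \<alpha> (factor_at x k n)"
  then obtain k where "P (factor_at x k n)" "wins (generated_subshift x) \<alpha> (factor_at x k n)" by blast
  moreover have "length (factor_at x k n) = n" by simp
  ultimately show "\<exists>g. length g = n \<and> P g \<and> wins (generated_subshift x) \<alpha> g" by blast
qed

text \<open>Every factor of \<open>x\<close> extends to a point of the orbit closure, so Alice never loses
  once all the remaining choices are forced.\<close>
lemma wins_zero_iff:
  assumes "\<And>j. j \<ge> length h \<Longrightarrow> \<alpha> j = 0"
  shows "wins (generated_subshift x) \<alpha> h \<longleftrightarrow> (\<exists>i. h = factor_at x i (length h))"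
proof
  assume "\<exists>i. h = factor_at x i (length h)"
  then obtain i where h: "h = factor_at x i (length h)" by blast
  let ?p = "length h"
  show "wins (generated_subshift x) \<alpha> h"
    unfolding wins_def
  proof (intro exI[of _ "\<lambda>g. {x (i + ?p + length g)}"] conjI allI impI)
    fix b assume "\<forall>j. b j \<in> {x (i + ?p + length (map b [0..<j]))}"
    then have "b j = x (i + (?p + j))" for j by (simp add: add.assoc)
    moreover have "h ! j = x (i + j)" if "j < ?p" for j by (subst h) (simp add: that)
    ultimately have "prepend h b = (\<lambda>j. x (i + j))" by (auto simp: prepend_def fun_eq_iff)
    then show "prepend h b \<in> generated_subshift x"
      by (auto simp: generated_subshift_iff factors_def)
  qed (simp add: assms)
qed (metis wins_imp_factor)

text \<open>In a round with \<open>\<alpha> j = 0\<close> Bob has no choice, so Alice alone selects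
  the continuation up to position \<open>n\<close>.\<close>

lemma wins_extend_iff:
  assumes "\<And>j. length h \<le> j \<Longrightarrow> j < n \<Longrightarrow> \<alpha> j = 0" "length h \<le> n"
  shows "wins X \<alpha> h \<longleftrightarrow> (\<exists>g. length g = n \<and> take (length h) g = h \<and> wins X \<alpha> g)"
  using assms
proof (induction "n - length h" arbitrary: h)
  case 0
  then show ?case by auto
next
  case (Suc d)
  then have lt: "length h < n" by simp
  have "wins X \<alpha> h \<longleftrightarrow> (\<exists>a. wins X \<alpha> (h @ [a]))"
    unfolding wins_unfold[of X \<alpha> h] using Suc.prems lt by (auto simp: card_1_singleton_iff)
  also have "\<dots> \<longleftrightarrow> (\<exists>a g. length g = n \<and> take (Suc (length h)) g = h @ [a] \<and> wins X \<alpha> g)"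
  proof -
    have "wins X \<alpha> (h @ [a]) \<longleftrightarrow>
        (\<exists>g. length g = n \<and> take (length (h @ [a])) g = h @ [a] \<and> wins X \<alpha> g)" for a
      by (rule Suc.hyps(1)) (use Suc lt in auto)
    then show ?thesis by simp
  qed
  also have "\<dots> \<longleftrightarrow> (\<exists>g. length g = n \<and> take (length h) g = h \<and> wins X \<alpha> g)"
  proof -
    have "take (Suc (length h)) g = h @ [a] \<longleftrightarrow> take (length h) g = h \<and> g ! length h = a"
      if "length g = n" for a g
      using lt that by (auto simp: take_Suc_conv_app_nth)
    then show ?thesis by blast
  qed
  finally show ?case .
qed

section \<open>Winning choice sequences of finite sum\<close>

definition agree :: "(nat \<Rightarrow> 'a) \<Rightarrow> nat \<Rightarrow> nat \<Rightarrow> nat \<Rightarrow> bool" where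
  "agree x i j n \<longleftrightarrow> (\<forall>t<n. x (i + t) = x (j + t))"

text \<open>\<open>branch_win x c ns i q\<close> says that Alice wins after the history \<open>x[i..i+q)\<close> when
  position \<open>q\<close> has the value \<open>c\<close> plus the multiplicity of \<open>q\<close> in the sorted list \<open>ns\<close> and the
  later positions have their multiplicities in \<open>ns\<close>.\<close>
primrec branch_win :: "(nat \<Rightarrow> 'a::finite) \<Rightarrow> nat \<Rightarrow> nat list \<Rightarrow> nat \<Rightarrow> nat \<Rightarrow> bool" where
  "branch_win x c [] i q \<longleftrightarrow>
     (\<exists>A. card A = Suc c \<and> (\<forall>a\<in>A. \<exists>k. agree x k i q \<and> x (k + q) = a))"
| "branch_win x c (n # ns) i q \<longleftrightarrow>
     (n = q \<and> branch_win x (Suc c) ns i q) \<or>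
     (q < n \<and> (\<exists>A. card A = Suc c \<and>
        (\<forall>a\<in>A. \<exists>k. agree x k i q \<and> x (k + q) = a \<and> branch_win x 1 ns k n)))"

lemma factor_at_snoc_eq_iff:
  "factor_at x k (Suc q) = factor_at x i q @ [a] \<longleftrightarrow> agree x k i q \<and> x (k + q) = a"
  by (auto simp: agree_def)

text \<open>Induction on the list. The number \<open>c\<close> keeps the copies of \<open>q\<close>
  already taken from the list, so the assumption on \<open>\<alpha>\<close> is preserved when the
  head equals \<open>q\<close>. A gap between \<open>q\<close> and a larger head consists of forced
  rounds and is bridged by \<open>wins_extend_iff\<close>.\<close>

lemma branch_win_iff:
  assumes "sorted ns" "\<forall>n\<in>set ns. q \<le> n"
    and "\<And>j. j \<ge> q \<Longrightarrow> \<alpha> j = (if j = q then c else 0) + count_list ns j"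
  shows "branch_win x c ns i q \<longleftrightarrow> wins (generated_subshift x) \<alpha> (factor_at x i q)"
  using assms
proof (induction ns arbitrary: c i q)
  case Nil
  have "wins (generated_subshift x) \<alpha> (factor_at x i q @ [a]) \<longleftrightarrow>
      (\<exists>k. agree x k i q \<and> x (k + q) = a)" for a
  proof -
    have "wins (generated_subshift x) \<alpha> (factor_at x i q @ [a]) \<longleftrightarrow>
        (\<exists>k. factor_at x i q @ [a] = factor_at x k (length (factor_at x i q @ [a])))"
      by (rule wins_zero_iff) (use Nil.prems(3) in auto)
    also have "length (factor_at x i q @ [a]) = Suc q" by simp
    finally show ?thesis
      by (simp only: eq_commute[of "factor_at x i q @ [a]"] factor_at_snoc_eq_iff)
  qed
  moreover have "\<alpha> q = c" using Nil.prems(3)[of q] by simp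
  ultimately show ?case by (subst wins_unfold) simp
next
  case (Cons n ns)
  consider "n = q" | "q < n" using Cons.prems(2) by fastforce
  then show ?case
  proof cases
    case 1
    have "branch_win x (Suc c) ns i q \<longleftrightarrow> wins (generated_subshift x) \<alpha> (factor_at x i q)"
      by (rule Cons.IH) (use Cons.prems 1 in auto)
    then show ?thesis using 1 by simp
  next
    case 2
    have ge: "\<forall>m\<in>set ns. n \<le> m" using Cons.prems(1) by simp
    have cnt: "count_list ns j = 0" if "j < n" for j
      using ge that by (auto simp: count_list_0_iff)
    have IH: "branch_win x 1 ns k n \<longleftrightarrow> wins (generated_subshift x) \<alpha> (factor_at x k n)" for k
    proof (rule Cons.IH[OF _ ge])
      show "sorted ns" using Cons.prems(1) by simp
      show "\<alpha> j = (if j = n then 1 else 0) + count_list ns j" if "n \<le> j" for j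
        using Cons.prems(3)[of j] that 2 by auto
    qed
    have "wins (generated_subshift x) \<alpha> (factor_at x i q @ [a]) \<longleftrightarrow>
        (\<exists>k. agree x k i q \<and> x (k + q) = a \<and> branch_win x 1 ns k n)" for a
    proof -
      have "wins (generated_subshift x) \<alpha> (factor_at x i q @ [a]) \<longleftrightarrow>
        (\<exists>g. length g = n \<and> take (length (factor_at x i q @ [a])) g = factor_at x i q @ [a] \<and>
           wins (generated_subshift x) \<alpha> g)"
        by (rule wins_extend_iff) (use 2 Cons.prems(3) cnt in auto)
      also have "\<dots> \<longleftrightarrow> (\<exists>k. take (length (factor_at x i q @ [a])) (factor_at x k n) =
           factor_at x i q @ [a] \<and> wins (generated_subshift x) \<alpha> (factor_at x k n))"
        by (rule ex_wins_factor_iff)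
      also have "length (factor_at x i q @ [a]) = Suc q" by simp
      finally have "wins (generated_subshift x) \<alpha> (factor_at x i q @ [a]) \<longleftrightarrow>
        (\<exists>k. take (Suc q) (factor_at x k n) = factor_at x i q @ [a] \<and>
           wins (generated_subshift x) \<alpha> (factor_at x k n))" .
      moreover have "take (Suc q) (factor_at x k n) = factor_at x k (Suc q)" for k
        using 2 by (simp only: take_map take_upt add_0 Suc_leI)
      ultimately show ?thesis by (simp only: factor_at_snoc_eq_iff IH conj_assoc)
    qed
    moreover have "\<alpha> q = c" using Cons.prems(3)[of q] 2 cnt[OF 2] by simp
    ultimately show ?thesis using 2 by (subst wins_unfold) simp
  qed
qed

text \<open>The rounds before the first entry are forced, so Alice may start from any factor of that
  length. The initial 1 counts the head of the list.\<close>

definition tuple_win :: "(nat \<Rightarrow> 'a::finite) \<Rightarrow> nat list \<Rightarrow> bool" where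
  "tuple_win x ns \<longleftrightarrow> ns = [] \<or> (\<exists>i. branch_win x 1 (tl ns) i (hd ns))"

lemma tuple_win_iff:
  fixes x :: "nat \<Rightarrow> 'a::finite"
  assumes "sorted ns"
  shows "tuple_win x ns \<longleftrightarrow> count_list ns \<in> winning_shift (generated_subshift x)"
proof (cases ns)
  case Nil
  then show ?thesis by (simp add: tuple_win_def winning_shift_iff wins_zero_iff)
next
  case (Cons n ms)
  have ge: "\<forall>m\<in>set ms. n \<le> m" using assms Cons by simp
  have B: "branch_win x (Suc 0) ms i n \<longleftrightarrow> wins (generated_subshift x) (count_list ns) (factor_at x i n)" for i
    by (rule branch_win_iff[OF _ ge]) (use assms Cons in auto)
  have "wins (generated_subshift x) (count_list ns) [] \<longleftrightarrow>
     (\<exists>g. length g = n \<and> take (length ([] :: 'a list)) g = [] \<and>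
        wins (generated_subshift x) (count_list ns) g)"
  proof (rule wins_extend_iff)
    fix j assume "j < n"
    then show "count_list ns j = 0" using ge Cons by (auto simp: count_list_0_iff)
  qed simp
  also have "\<dots> \<longleftrightarrow> (\<exists>i. take (length ([] :: 'a list)) (factor_at x i n) = [] \<and>
      wins (generated_subshift x) (count_list ns) (factor_at x i n))"
    by (rule ex_wins_factor_iff)
  finally show ?thesis using Cons by (simp add: tuple_win_def winning_shift_iff B)
qed

section \<open>Codes of sequences as sorted tuples\<close>

lemma count_list_eq_imp_eq:
  assumes "sorted ns" "sorted ms" "count_list ns = count_list ms"
  shows "ns = ms"
proof -
  have "mset ns = mset ms" using assms(3) by (auto simp: multiset_eq_iff count_mset fun_eq_iff)
  then show ?thesis using assms properties_for_sort sorted_sort_id by metis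
qed

lemma nu_count_list: "sorted ns \<Longrightarrow> nu (count_list ns) = ns"
  unfolding nu_def
proof (rule the_equality)
  fix ms assume "sorted ns" "sorted ms \<and> (\<forall>j. count_list ms j = count_list ns j)"
  then show "ms = ns" by (intro count_list_eq_imp_eq) auto
qed auto

lemma finite_support_as_count_list:
  assumes "finite {i. y i \<noteq> 0}"
  obtains ns where "sorted ns" "count_list ns = y" "length ns = (\<Sum>i\<in>{i. y i \<noteq> 0}. y i)"
proof -
  define M where "M = Abs_multiset y"
  have cM: "count M = y" unfolding M_def using assms by (simp add: count_Abs_multiset)
  define ns where "ns = sorted_list_of_multiset M"
  have m: "mset ns = M" by (simp add: ns_def)
  have "count_list ns = y" using cM m by (metis count_mset ext)
  moreover have "length ns = (\<Sum>i\<in>{i. y i \<noteq> 0}. y i)"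
  proof -
    have "set_mset M = {i. y i \<noteq> 0}" unfolding cM[symmetric] by (auto simp: count_eq_zero_iff)
    then have "size M = (\<Sum>i\<in>{i. y i \<noteq> 0}. y i)"
      by (simp add: size_multiset_overloaded_eq cM)
    then show ?thesis using m by (metis size_mset)
  qed
  ultimately show ?thesis using that[of ns] by (simp add: ns_def)
qed

lemma seq_sum_le_count_list: "seq_sum_le (count_list ns) k \<longleftrightarrow> length ns \<le> k"
proof -
  have "{i. count_list ns i \<noteq> 0} = set ns" by (auto simp: count_list_0_iff)
  then show ?thesis by (simp add: seq_sum_le_def sum_count_set)
qed

text \<open>On sorted lists \<open>nu\<close> inverts \<open>count_list\<close>, and the sum of a
  sequence is the length of its code. Hence the set of codes of length \<open>i\<close> is the same
  for every bound \<open>k\<close> with \<open>i \<le> k\<close>.\<close>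

lemma nu_image_eq:
  assumes "i \<le> k"
  shows "{ns \<in> {nu y |y. y \<in> winning_shift (generated_subshift x) \<and> seq_sum_le y k}. length ns = i} =
    {ns. length ns = i \<and> sorted ns \<and> tuple_win x ns}"
proof (intro set_eqI iffI)
  fix ns
  assume "ns \<in> {ns \<in> {nu y |y. y \<in> winning_shift (generated_subshift x) \<and> seq_sum_le y k}. length ns = i}"
  then obtain y where y: "ns = nu y" "y \<in> winning_shift (generated_subshift x)" "seq_sum_le y k"
    "length ns = i" by blast
  then obtain ms where ms: "sorted ms" "count_list ms = y"
    using finite_support_as_count_list[of y] unfolding seq_sum_le_def by blast
  then have "ns = ms" using y(1) nu_count_list by blast
  then show "ns \<in> {ns. length ns = i \<and> sorted ns \<and> tuple_win x ns}"
    using ms y tuple_win_iff[OF ms(1), of x] by simp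
next
  fix ns
  assume "ns \<in> {ns. length ns = i \<and> sorted ns \<and> tuple_win x ns}"
  then have "ns = nu (count_list ns)" "count_list ns \<in> winning_shift (generated_subshift x)"
    "seq_sum_le (count_list ns) k" "length ns = i"
    using assms by (auto simp: nu_count_list seq_sum_le_count_list tuple_win_iff)
  then show "ns \<in> {ns \<in> {nu y |y. y \<in> winning_shift (generated_subshift x) \<and> seq_sum_le y k}. length ns = i}"
    by blast
qed

lemma nu_length_le:
  assumes "seq_sum_le y k"
  shows "length (nu y) \<le> k"
proof -
  obtain ns where "sorted ns" "count_list ns = y" "length ns = (\<Sum>i\<in>{i. y i \<noteq> 0}. y i)"
    using finite_support_as_count_list[of y] assms unfolding seq_sum_le_def by blast
  then show ?thesis using assms nu_count_list unfolding seq_sum_le_def by fastforce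
qed

subsection \<open>Recognizability of the winning tuples\<close>

text \<open>Variables of a formula are modelled as functions of the tuple. Below a quantifier the
  bound variable is \<open>hd\<close> and the outer ones are read from \<open>tl\<close>, in the
  manner of de Bruijn indices.\<close>

definition is_coord :: "nat \<Rightarrow> (nat list \<Rightarrow> nat) \<Rightarrow> bool" where
  "is_coord d t \<longleftrightarrow> (\<exists>i<d. \<forall>ns. length ns = d \<longrightarrow> t ns = ns ! i)"

lemma is_coord_nth: "i < d \<Longrightarrow> is_coord d (\<lambda>ns. ns ! i)"
  by (auto simp: is_coord_def)

lemma is_coord_hd: "is_coord (Suc d) (\<lambda>ns. hd ns)"
  unfolding is_coord_def by (rule exI[of _ 0]) (auto simp: length_Suc_conv)

lemma is_coord_tl: "is_coord d t \<Longrightarrow> is_coord (Suc d) (\<lambda>ns. t (tl ns))"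
proof -
  assume "is_coord d t"
  then obtain i where "i < d" "\<And>ns. length ns = d \<Longrightarrow> t ns = ns ! i" unfolding is_coord_def by blast
  then show ?thesis
    unfolding is_coord_def by (intro exI[of _ "Suc i"]) (auto simp: nth_tl)
qed

section \<open>First-order formulas about an automatic word\<close>

context addable_system
begin

lemma definable_coords3:
  assumes "definable rep 3 (\<lambda>ns. R (ns ! 0) (ns ! 1) (ns ! 2))"
    and "is_coord d s" "is_coord d t" "is_coord d u"
  shows "definable rep d (\<lambda>ns. R (s ns) (t ns) (u ns))"
proof -
  obtain i j k where ijk: "i < d" "\<And>ns. length ns = d \<Longrightarrow> s ns = ns ! i"
    "j < d" "\<And>ns. length ns = d \<Longrightarrow> t ns = ns ! j"
    "k < d" "\<And>ns. length ns = d \<Longrightarrow> u ns = ns ! k"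
    using assms(2-4) unfolding is_coord_def by blast
  show ?thesis
    by (rule definable_cong[OF definable_reindex[OF assms(1),
            of "\<lambda>l. if l = 0 then i else if l = 1 then j else k" d]])
      (use ijk in \<open>auto simp: numeral_3_eq_3 numeral_2_eq_2\<close>)
qed

lemma definable_coord1:
  assumes "definable rep 1 (\<lambda>ns. R (ns ! 0))" "is_coord d s"
  shows "definable rep d (\<lambda>ns. R (s ns))"
proof -
  obtain i where i: "i < d" "\<And>ns. length ns = d \<Longrightarrow> s ns = ns ! i"
    using assms(2) unfolding is_coord_def by blast
  show ?thesis
    by (rule definable_cong[OF definable_reindex[OF assms(1), of "\<lambda>l. i" d]]) (use i in auto)
qed

lemma definable_plus:
  "is_coord d s \<Longrightarrow> is_coord d t \<Longrightarrow> is_coord d u \<Longrightarrow> definable rep d (\<lambda>ns. s ns + t ns = u ns)"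
  by (rule definable_coords3[OF definable_add])

lemma definable_le:
  assumes "is_coord d s" "is_coord d t"
  shows "definable rep d (\<lambda>ns. s ns \<le> t ns)"
proof -
  have "definable rep d (\<lambda>ns. \<exists>m. s ns + m = t ns)"
    by (intro definable_ex definable_plus is_coord_hd is_coord_tl assms)
  then show ?thesis by (rule definable_cong) (metis le_iff_add)
qed

lemma definable_less:
  assumes "is_coord d s" "is_coord d t"
  shows "definable rep d (\<lambda>ns. s ns < t ns)"
  using definable_not[OF definable_le[OF assms(2,1)]] by (simp add: not_le)

lemma definable_eq:
  assumes "is_coord d s" "is_coord d t"
  shows "definable rep d (\<lambda>ns. s ns = t ns)"
  using definable_conj[OF definable_le[OF assms] definable_le[OF assms(2,1)]]
  by (simp add: eq_iff)

text \<open>The automaton of \<open>x\<close> runs on the word with its padding deleted, and its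
  state determines the quotient. Intersecting with the valid encodings removes all other
  words.\<close>

lemma definable_letter1:
  assumes "automatic rep x"
  shows "definable rep 1 (\<lambda>ns. x (ns ! 0) = a)"
proof -
  obtain Q :: "nat set" and q0 and \<delta> :: "nat \<Rightarrow> 'b \<Rightarrow> nat" and out
    where Q: "finite Q" "q0 \<in> Q" "\<forall>q\<in>Q. \<forall>c. \<delta> q c \<in> Q"
      and x: "\<And>n. x n = out (foldl \<delta> q0 (rep n))"
    using assms unfolding automatic_def by blast
  let ?strip = "List.map_filter (\<lambda>c :: 'b option list. c ! 0)"
  let ?L = "{w. out (foldl \<delta> q0 (?strip w)) = a}"
  have app: "?strip (u @ v) = ?strip u @ ?strip v" for u v by (simp add: map_filter_def)
  have strip: "?strip w = rep (ns ! 0)" if "length ns = 1" "encodes rep w ns" for w ns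
  proof -
    have "padded (rep (ns ! 0)) (map (\<lambda>c. c ! 0) w)" using that by (simp add: encodes_def)
    then have "List.map_filter id (map (\<lambda>c. c ! 0) w) = rep (ns ! 0)"
      by (rule map_filter_padded)
    then show ?thesis by (simp add: map_filter_def filter_map o_def)
  qed
  have "w \<in> enc_lang rep 1 (\<lambda>ns. x (ns ! 0) = a) \<longleftrightarrow> w \<in> enc_lang rep 1 (\<lambda>_. True) \<inter> ?L" for w
  proof (cases "\<exists>ns. length ns = 1 \<and> encodes rep w ns")
    case True
    then obtain ns where ns: "length ns = 1" "encodes rep w ns" by blast
    note eq = enc_lang_iff[OF ns]
    show ?thesis by (simp only: eq Int_iff mem_Collect_eq simp_thms strip[OF ns] x)
  qed (auto simp: enc_lang_def)
  then have "enc_lang rep 1 (\<lambda>ns. x (ns ! 0) = a) = enc_lang rep 1 (\<lambda>_. True) \<inter> ?L" by blast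
  moreover have "fin_index ?L"
  proof (rule fin_indexI[where f = "\<lambda>u. foldl \<delta> q0 (?strip u)"
        and g = "\<lambda>q. {v. out (foldl \<delta> q (?strip v)) = a}"])
    show "finite (range (\<lambda>u. foldl \<delta> q0 (?strip u)))"
      by (rule finite_subset[OF _ Q(1)]) (use foldl_state_in[OF Q(2,3)] in auto)
  qed (simp add: lquot_def app)
  ultimately show ?thesis
    using definable_True[of 1] unfolding definable_def by (simp only: fin_index_Int)
qed

text \<open>A sum is not a coordinate, so it is first named by a quantified variable
  \<open>m\<close>.\<close>

lemma definable_letter:
  assumes "automatic rep x" "is_coord d s" "is_coord d t"
  shows "definable rep d (\<lambda>ns. x (s ns + t ns) = a)"
proof -
  have "definable rep d (\<lambda>ns. \<exists>m. s ns + t ns = m \<and> x m = a)"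
    by (intro definable_ex definable_conj definable_plus is_coord_hd is_coord_tl assms(2,3)
        definable_coord1[OF definable_letter1[OF assms(1)]])
  then show ?thesis by (rule definable_cong) simp
qed

lemma definable_agree:
  fixes x :: "nat \<Rightarrow> 'a::finite"
  assumes "automatic rep x" "is_coord d s" "is_coord d t" "is_coord d u"
  shows "definable rep d (\<lambda>ns. agree x (s ns) (t ns) (u ns))"
proof -
  \<comment> \<open>Equality of two letters is a finite disjunction over the alphabet, and the
    bounded universal quantifier is written with negations.\<close>
  have "definable rep d (\<lambda>ns. \<not> (\<exists>m. m < u ns \<and>
      \<not> (\<exists>a\<in>UNIV. x (s ns + m) = a \<and> x (t ns + m) = a)))"
    by (intro definable_not definable_ex definable_conj definable_bex definable_less
        definable_letter[OF assms(1)] is_coord_hd is_coord_tl assms(2-4)) simp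
  then show ?thesis by (rule definable_cong) (auto simp: agree_def)
qed

text \<open>The two position arguments stand in front of the list. They may be replaced by any
  coordinates of a tuple in which \<open>r\<close> entries precede the list.\<close>

lemma definable_drop_coords:
  assumes "definable rep (d + 2) (\<lambda>ns. P (drop 2 ns) (ns ! 0) (ns ! 1))"
    and "is_coord (r + d) s" "is_coord (r + d) t"
  shows "definable rep (r + d) (\<lambda>ns. P (drop r ns) (s ns) (t ns))"
proof -
  obtain i j where ij: "i < r + d" "\<And>ns. length ns = r + d \<Longrightarrow> s ns = ns ! i"
    "j < r + d" "\<And>ns. length ns = r + d \<Longrightarrow> t ns = ns ! j"
    using assms(2,3) unfolding is_coord_def by blast
  let ?f = "\<lambda>l. if l = 0 then i else if l = 1 then j else r + (l - 2)"
  have m: "map (\<lambda>l. ns ! ?f l) [0..<d + 2] = s ns # t ns # drop r ns" if "length ns = r + d" for ns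
  proof (rule nth_equalityI)
    fix l assume "l < length (map (\<lambda>l. ns ! ?f l) [0..<d + 2])"
    then have l: "l < d + 2" by simp
    then have "map (\<lambda>l. ns ! ?f l) [0..<d + 2] ! l = ns ! ?f l" by (subst nth_map_upt) auto
    also have "ns ! ?f l = (s ns # t ns # drop r ns) ! l"
    proof -
      consider "l = 0" | "l = 1" | k where "l = Suc (Suc k)"
        by (metis One_nat_def not0_implies_Suc)
      then show ?thesis by cases (use that ij l in auto)
    qed
    finally show "map (\<lambda>l. ns ! ?f l) [0..<d + 2] ! l = (s ns # t ns # drop r ns) ! l" .
  qed (use that in simp)
  show ?thesis
  proof (rule definable_cong[OF definable_reindex[OF assms(1), of ?f "r + d"]])
    show "?f l < r + d" if "l < d + 2" for l using that ij by auto
    show "P (drop 2 (map (\<lambda>l. ns ! ?f l) [0..<d + 2])) (map (\<lambda>l. ns ! ?f l) [0..<d + 2] ! 0)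
        (map (\<lambda>l. ns ! ?f l) [0..<d + 2] ! 1) \<longleftrightarrow> P (drop r ns) (s ns) (t ns)"
      if "length ns = r + d" for ns
      unfolding m[OF that] by simp
  qed
qed

text \<open>For each fixed length \<open>d\<close> the recursion unrolls into one formula. The
  choice of Alice's set is a finite disjunction because the alphabet is finite.\<close>

lemma definable_branch_win:
  fixes x :: "nat \<Rightarrow> 'a::finite"
  assumes x: "automatic rep x"
  shows "definable rep (d + 2) (\<lambda>ns. branch_win x c (drop 2 ns) (ns ! 0) (ns ! 1))"
proof (induction d arbitrary: c)
  case 0
  have "definable rep (0 + 2) (\<lambda>ns. \<exists>A\<in>{A. card A = Suc c}.
      \<forall>a\<in>A. \<exists>k. agree x k (ns ! 0) (ns ! 1) \<and> x (k + ns ! 1) = a)"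
    by (intro definable_bex definable_ball definable_ex definable_conj definable_agree[OF x]
        definable_letter[OF x] is_coord_hd is_coord_tl is_coord_nth) auto
  then show ?case by (rule definable_cong) simp
next
  case (Suc d)
  let ?e = "3 + d"
  have B1: "definable rep ?e (\<lambda>ns. branch_win x (Suc c) (drop 3 ns) (ns ! 0) (ns ! 1))"
    by (intro definable_drop_coords[OF Suc.IH] is_coord_nth) auto
  \<comment> \<open>The quantified position \<open>k\<close> is put in front of the tuple, so the
    entry \<open>n\<close> moves from coordinate 2 to 3 and the rest of the list starts at
    4.\<close>
  have e: "4 + d = Suc ?e" by simp
  have "definable rep (4 + d) (\<lambda>us. branch_win x 1 (drop 4 us) (us ! 0) (us ! 3))"
    by (intro definable_drop_coords[OF Suc.IH] is_coord_nth) auto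
  then have "definable rep (Suc ?e) (\<lambda>us. branch_win x 1 (drop 4 us) (us ! 0) (us ! 3))"
    by (subst (asm) e)
  then have B2: "definable rep (Suc ?e) (\<lambda>us. branch_win x 1 (drop 3 (tl us)) (hd us) (tl us ! 2))"
    by (rule definable_cong) (auto simp: length_Suc_conv numeral_eq_Suc)
  have "definable rep ?e (\<lambda>ns. (ns ! 2 = ns ! 1 \<and> branch_win x (Suc c) (drop 3 ns) (ns ! 0) (ns ! 1)) \<or>
      (ns ! 1 < ns ! 2 \<and> (\<exists>A\<in>{A. card A = Suc c}. \<forall>a\<in>A. \<exists>k. agree x k (ns ! 0) (ns ! 1) \<and>
         x (k + ns ! 1) = a \<and> branch_win x 1 (drop 3 ns) k (ns ! 2))))"
    by (intro definable_disj definable_conj definable_eq definable_less B1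
        definable_bex definable_ball definable_ex definable_agree[OF x]
        definable_letter[OF x] B2 is_coord_hd is_coord_tl is_coord_nth) auto
  then have "definable rep ?e (\<lambda>ns. branch_win x c (drop 2 ns) (ns ! 0) (ns ! 1))"
  proof (rule definable_cong)
    fix ns :: "nat list" assume "length ns = 3 + d"
    then have "drop 2 ns = ns ! 2 # drop 3 ns"
      using Cons_nth_drop_Suc[of 2 ns] by (simp add: numeral_3_eq_3 numeral_2_eq_2)
    then show "(ns ! 2 = ns ! 1 \<and> branch_win x (Suc c) (drop 3 ns) (ns ! 0) (ns ! 1)) \<or>
      (ns ! 1 < ns ! 2 \<and> (\<exists>A\<in>{A. card A = Suc c}. \<forall>a\<in>A. \<exists>k. agree x k (ns ! 0) (ns ! 1) \<and>
         x (k + ns ! 1) = a \<and> branch_win x 1 (drop 3 ns) k (ns ! 2))) \<longleftrightarrow>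
      branch_win x c (drop 2 ns) (ns ! 0) (ns ! 1)"
      by simp
  qed
  moreover have "Suc d + 2 = ?e" by simp
  ultimately show ?case by metis
qed

lemma definable_sorted: "definable rep d sorted"
proof -
  have "definable rep d (\<lambda>ns. \<forall>i\<in>{i. Suc i < d}. ns ! i \<le> ns ! Suc i)"
    by (intro definable_ball definable_le is_coord_nth) (auto intro: finite_subset[of _ "{..<d}"])
  then show ?thesis by (rule definable_cong) (auto simp: sorted_iff_nth_Suc)
qed

lemma definable_tuple_win:
  assumes "automatic rep x"
  shows "definable rep d (tuple_win x)"
proof (cases d)
  case 0
  then show ?thesis
    using definable_True[of 0] by (auto simp: tuple_win_def elim: definable_cong)
next
  case (Suc e)
  have "definable rep (Suc (Suc e)) (\<lambda>us. branch_win x 1 (tl (tl us)) (hd us) (hd (tl us)))"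
    by (rule definable_cong[OF definable_branch_win[OF assms, of e 1, unfolded add_2_eq_Suc']])
      (auto simp: length_Suc_conv numeral_2_eq_2)
  then have "definable rep (Suc e) (\<lambda>ns. \<exists>i. branch_win x 1 (tl ns) i (hd ns))"
    by (rule definable_ex)
  then have "definable rep (Suc e) (tuple_win x)"
    by (rule definable_cong) (auto simp: tuple_win_def)
  then show ?thesis using Suc by simp
qed

lemma weakly_codable_winning_shift:
  assumes "automatic rep x"
  shows "weakly_codable rep (winning_shift (generated_subshift x))"
proof -
  have "recognizable rep i {ns. length ns = i \<and> sorted ns \<and> tuple_win x ns}" for i
    by (rule recognizable_if_definable)
      (intro definable_conj definable_sorted definable_tuple_win assms)
  then show ?thesis
    unfolding weakly_codable_def recognizable_le_def
    by (auto simp only: nu_image_eq intro: nu_length_le)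
qed

end

subsection \<open>Right special factors of words of linear complexity\<close>

text \<open>Extending \<open>x\<close> to the left by \<open>None\<close> lets windows start at negative positions while adding
  only linearly many of them.\<close>
definition window :: "(nat \<Rightarrow> 'a) \<Rightarrow> nat \<Rightarrow> int \<Rightarrow> 'a option list" where
  "window x N i = map (\<lambda>k. if i + int k < 0 then None else Some (x (nat (i + int k)))) [0..<N]"

lemma window_nth:
  "j < N \<Longrightarrow> int j = int s + int k \<Longrightarrow> window x N (int i - int s) ! j = Some (x (i + k))"
  by (simp add: window_def nat_add_distrib)

lemma finite_factors: "finite (factors (x :: nat \<Rightarrow> 'a::finite) n)"
proof (rule finite_subset)
  show "factors x n \<subseteq> {xs. set xs \<subseteq> UNIV \<and> length xs = n}" by (auto simp: factors_def)
  show "finite {xs :: 'a list. set xs \<subseteq> UNIV \<and> length xs = n}"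
    by (rule finite_lists_length_eq) simp
qed

text \<open>Windows from nonnegative positions are factors, and those starting left of
  \<open>- N\<close> consist of \<open>None\<close> only, like the one at \<open>- N\<close>. This
  leaves \<open>N + 1\<close> further starting positions.\<close>

lemma windows_subset:
  "range (window x N) \<subseteq> map Some ` factors x N \<union> window x N ` {- int N..0}"
proof
  fix w assume "w \<in> range (window x N)"
  then obtain i where w: "w = window x N i" by blast
  consider "i \<ge> 0" | "- int N \<le> i" "i \<le> 0" | "i < - int N" by linarith
  then show "w \<in> map Some ` factors x N \<union> window x N ` {- int N..0}"
  proof cases
    case 1
    then have "w = map Some (map (\<lambda>j. x (nat i + j)) [0..<N])"
      by (simp add: w window_def nat_add_distrib)
    then show ?thesis unfolding factors_def by blast
  next
    case 2
    then show ?thesis using w by auto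
  next
    case 3
    then have "w = window x N (- int N)" by (auto simp: w window_def)
    then show ?thesis by auto
  qed
qed

lemma finite_windows: "finite (range (window (x :: nat \<Rightarrow> 'a::finite) N))"
  by (rule finite_subset[OF windows_subset]) (simp add: finite_factors)

lemma card_windows:
  "card (range (window (x :: nat \<Rightarrow> 'a::finite) N)) \<le> factor_complexity x N + N + 1"
proof -
  have "card (range (window x N)) \<le> card (map Some ` factors x N \<union> window x N ` {- int N..0})"
    by (rule card_mono[OF _ windows_subset]) (simp add: finite_factors)
  also have "\<dots> \<le> card (map Some ` factors x N) + card (window x N ` {- int N..0})"
    by (rule card_Un_le)
  also have "\<dots> \<le> card (factors x N) + card {- int N..0}"
    by (intro add_mono card_image_le) (auto simp: finite_factors)
  finally show ?thesis by (simp add: factor_complexity_def nat_add_distrib)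
qed

text \<open>Having two different extensions is phrased as being able to avoid any given letter,
  since this is how extensions are selected later.\<close>

definition right_special :: "(nat \<Rightarrow> 'a) \<Rightarrow> nat \<Rightarrow> 'a list set" where
  "right_special x n =
     {w. length w = n \<and> (\<forall>c. \<exists>i. (\<forall>k<n. x (i + k) = w ! k) \<and> x (i + n) \<noteq> c)}"

lemma right_special_subset: "right_special x n \<subseteq> factors x n"
proof
  fix w assume "w \<in> right_special x n"
  then obtain i where "length w = n" "\<forall>k<n. x (i + k) = w ! k"
    by (auto simp: right_special_def)
  then have "w = map (\<lambda>j. x (i + j)) [0..<n]" by (intro nth_equalityI) auto
  then show "w \<in> factors x n" by (auto simp: factors_def)
qed

text \<open>The same \<open>m\<close> bounds the ignored prefix and the period; it is also the
  number of shifts at which windows are taken.\<close>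

definition eventually_periodic :: "nat \<Rightarrow> nat \<Rightarrow> 'a list \<Rightarrow> bool" where
  "eventually_periodic m q w \<longleftrightarrow>
     0 < q \<and> q \<le> m \<and> (\<forall>k. m \<le> k \<and> k + q < length w \<longrightarrow> w ! k = w ! (k + q))"

lemma eventually_periodicD:
  assumes "eventually_periodic m q w" "m + q \<le> k" "k < length w"
  shows "w ! (k - q) = w ! k"
proof -
  have "m \<le> k - q \<and> k - q + q < length w" "k - q + q = k" using assms by auto
  then show ?thesis using assms(1) unfolding eventually_periodic_def by metis
qed

text \<open>The pairs of a factor \<open>w\<close> and a shift \<open>t < m\<close> inject into the
  windows: \<open>w\<close> is placed at position \<open>t\<close>, and its extension breaks the
  period inside the window.\<close>

lemma card_periodic_right_special:
  fixes x :: "nat \<Rightarrow> 'a::finite"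
  assumes "4 * m \<le> n" "0 < m"
  shows "card {w \<in> right_special x n. \<exists>q. eventually_periodic m q w} * m
    \<le> card (range (window x (2 * n)))"
proof -
  let ?B = "{w \<in> right_special x n. \<exists>q. eventually_periodic m q w}"
  define q where "q w = (SOME q. eventually_periodic m q w)" for w :: "'a list"
  have q: "eventually_periodic m (q w) w" if "w \<in> ?B" for w
    using that unfolding q_def by (metis (mono_tags, lifting) mem_Collect_eq someI_ex)
  \<comment> \<open>The avoided letter is the one that would continue the period of
    \<open>w\<close>.\<close>
  have "\<forall>w\<in>?B. \<exists>i. (\<forall>k<n. x (i + k) = w ! k) \<and> x (i + n) \<noteq> w ! (n - q w)"
    by (simp add: right_special_def)
  from bchoice[OF this] obtain i where i: "\<And>w. w \<in> ?B \<Longrightarrow>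
      (\<forall>k<n. x (i w + k) = w ! k) \<and> x (i w + n) \<noteq> w ! (n - q w)"
    by blast
  have qi: "eventually_periodic m (q w) w \<and> (\<forall>k<n. x (i w + k) = w ! k) \<and>
      x (i w + n) \<noteq> w ! (n - q w)" if "w \<in> ?B" for w
    using q[OF that] i[OF that] by blast
  define f where "f = (\<lambda>(w, t). window x (2 * n) (int (i w) - int t))"
  have len: "length w = n" if "w \<in> ?B" for w using that by (simp add: right_special_def)
  have fk: "f (w, t) ! j = Some (w ! (j - t))" if "w \<in> ?B" "t < m" "t \<le> j" "j < t + n" for w t j
  proof -
    have "f (w, t) ! j = Some (x (i w + (j - t)))"
      unfolding f_def case_prod_conv by (rule window_nth) (use that assms in auto)
    moreover have "j - t < n" using that by linarith
    then have "x (i w + (j - t)) = w ! (j - t)" using qi[OF that(1)] by blast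
    ultimately show ?thesis by simp
  qed
  have fn: "f (w, t) ! (t + n) \<noteq> Some (w ! (n - q w))" if "w \<in> ?B" "t < m" for w t
  proof -
    have "f (w, t) ! (t + n) = Some (x (i w + n))"
      unfolding f_def using that assms by (auto intro!: window_nth)
    then show ?thesis using qi[OF that(1)] by simp
  qed
  \<comment> \<open>If \<open>t < t'\<close>, the run of \<open>w'\<close> continues past the position where the run of \<open>w\<close> breaks.
    Going back by \<open>p'\<close>, then by \<open>p\<close>, and forward by \<open>p'\<close> within the two runs shows that there is
    no break.\<close>
  have no_shift: False
    if w: "w \<in> ?B" and w': "w' \<in> ?B" and t: "t < t'" "t' < m" and eq: "f (w, t) = f (w', t')"
    for w w' t t'
  proof -
    define p where "p = q w"
    define p' where "p' = q w'"
    define d where "d = t' - t"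
    have per: "eventually_periodic m p w" "eventually_periodic m p' w'"
      using qi[OF w] qi[OF w'] by (auto simp: p_def p'_def)
    have le: "0 < p" "p \<le> m" "0 < p'" "p' \<le> m" using per by (auto simp: eventually_periodic_def)
    have d: "t' = t + d" "0 < d" "d < m" using t by (auto simp: d_def)
    \<comment> \<open>\<open>A\<close> and \<open>B\<close> read the common window at distance
      \<open>r\<close> before the break of \<open>w\<close>, once through \<open>w\<close> and once
      through \<open>w'\<close>.\<close>
    have A: "f (w, t) ! (t + n - r) = Some (w ! (n - r))" if "0 < r" "r \<le> n" for r
      using fk[OF w, of t "t + n - r"] t that by simp
    have B: "f (w, t) ! (t + n - r) = Some (w' ! (n - d - r))" if "d + r \<le> n" for r
      using fk[OF w', of t' "t + n - r"] t that d eq by (simp add: add.commute)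
    have "f (w, t) ! (t + n) = Some (w' ! (n - d))" using B[of 0] d assms by simp
    also have "w' ! (n - d) = w' ! (n - d - p')"
      using eventually_periodicD[OF per(2), of "n - d"] le d assms len[OF w'] by simp
    also have "Some \<dots> = Some (w ! (n - p'))" using A[of p'] B[of p'] le d assms by simp
    also have "w ! (n - p') = w ! (n - p' - p)"
      using eventually_periodicD[OF per(1), of "n - p'"] le assms len[OF w] by simp
    also have "Some \<dots> = Some (w' ! (n - d - (p' + p)))"
      using A[of "p' + p"] B[of "p' + p"] le d assms by simp
    also have "w' ! (n - d - (p' + p)) = w' ! (n - d - p)"
    proof -
      have "n - d - (p' + p) = n - d - p - p'" by simp
      then show ?thesis
        using eventually_periodicD[OF per(2), of "n - d - p"] le d assms len[OF w'] by simp
    qed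
    also have "Some \<dots> = Some (w ! (n - p))" using A[of p] B[of p] le d assms by simp
    finally show False using fn[OF w, of t] t by (simp add: p_def)
  qed
  have "inj_on f (?B \<times> {..<m})"
  proof (rule inj_onI, unfold split_paired_all)
    fix w t w' t'
    assume "(w, t) \<in> ?B \<times> {..<m}" "(w', t') \<in> ?B \<times> {..<m}" and eq: "f (w, t) = f (w', t')"
    then have w: "w \<in> ?B" and w': "w' \<in> ?B" and t: "t < m" "t' < m" by blast+
    have tt: "t = t'" using no_shift[OF w w' _ t(2) eq] no_shift[OF w' w _ t(1) eq[symmetric]]
      by (cases t t' rule: linorder_cases) auto
    have "w = w'"
    proof (rule nth_equalityI)
      fix k assume "k < length w"
      then show "w ! k = w' ! k"
        using fk[OF w t(1), of "t + k"] fk[OF w' t(2), of "t + k"] eq tt len[OF w] by simp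
    qed (simp add: len[OF w] len[OF w'])
    with tt show "(w, t) = (w', t')" by simp
  qed
  then have "card (?B \<times> {..<m}) = card (f ` (?B \<times> {..<m}))" by (simp add: card_image)
  also have "\<dots> \<le> card (range (window x (2 * n)))"
    by (rule card_mono[OF finite_windows]) (auto simp: f_def)
  finally show ?thesis by (simp add: card_cartesian_product)
qed

text \<open>A double count: \<open>g\<close> sends pairs \<open>(w, s)\<close> to windows, and every
  fibre of \<open>g\<close>, combined with \<open>m\<close> further shifts, injects into the windows
  by \<open>h\<close>.\<close>

lemma card_aperiodic_right_special:
  fixes x :: "nat \<Rightarrow> 'a::finite"
  assumes "4 * m \<le> n" "0 < m"
  shows "card {w \<in> right_special x n. \<nexists>q. eventually_periodic m q w} * m * m
    \<le> card (range (window x (2 * n))) * card (range (window x (2 * n)))"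
proof -
  let ?N = "{w \<in> right_special x n. \<nexists>q. eventually_periodic m q w}"
  let ?Z = "range (window x (2 * n))"
  have len: "length w = n" if "w \<in> ?N" for w using that by (simp add: right_special_def)
  have "\<forall>w\<in>?N. \<exists>i. \<forall>k<n. x (i + k) = w ! k" 
    unfolding right_special_def by blast
  from bchoice[OF this] obtain i where i: "\<And>w k. w \<in> ?N \<Longrightarrow> k < n \<Longrightarrow> x (i w + k) = w ! k"
    by blast
  define g where "g = (\<lambda>(w, s). window x (2 * n) (int (i w) - int s))"
  have gk: "g (w, s) ! j = Some (w ! (j - s))" if "w \<in> ?N" "s < m" "s \<le> j" "j < s + n" for w s j
  proof -
    have "g (w, s) ! j = Some (x (i w + (j - s)))"
      unfolding g_def case_prod_conv by (rule window_nth) (use that assms in auto)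
    moreover have "j - s < n" using that by linarith
    then have "x (i w + (j - s)) = w ! (j - s)" by (rule i[OF that(1)])
    ultimately show ?thesis by simp
  qed
  have finN: "finite ?N"
    by (rule finite_subset[OF _ finite_factors[of x n]]) (use right_special_subset in blast)
  have fiber: "card {p \<in> ?N \<times> {..<m}. g p = v} * m \<le> card ?Z" for v
  proof -
    let ?S = "{p \<in> ?N \<times> {..<m}. g p = v}"
    have vk: "v ! j = Some (w ! (j - s))" if "(w, s) \<in> ?S" "s \<le> j" "j < s + n" for w s j
      using gk[of w s j] that by auto
    \<comment> \<open>Each \<open>w\<close> is extended by a letter other than the one of
      \<open>v\<close> just behind its place at \<open>s\<close>. If \<open>v\<close> has
      \<open>None\<close> there, any letter differs from it.\<close>
    have "\<forall>p\<in>?N \<times> UNIV. \<exists>l. (\<forall>k<n. x (l + k) = fst p ! k) \<and>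
        x (l + n) \<noteq> the (v ! (snd p + n))"
      by (auto simp: right_special_def)
    from bchoice[OF this] obtain l' where l': "\<And>p. p \<in> ?N \<times> UNIV \<Longrightarrow>
        (\<forall>k<n. x (l' p + k) = fst p ! k) \<and> x (l' p + n) \<noteq> the (v ! (snd p + n))"
      by blast
    define l where "l w s = l' (w, s)" for w s
    have l: "x (l w s + k) = w ! k" if "w \<in> ?N" "k < n" for w s k
      using l'[of "(w, s)"] that by (simp add: l_def)
    have ln: "Some (x (l w s + n)) \<noteq> v ! (s + n)" if "w \<in> ?N" for w s
      using l'[of "(w, s)"] that by (auto simp: l_def dest: sym)
    \<comment> \<open>All words of the fibre are aligned by their places \<open>s\<close> in
      \<open>v\<close>, and \<open>t\<close> shifts this common frame.\<close>
    define h where "h = (\<lambda>((w, s), t). window x (2 * n) (int (l w s) - int (s + t)))"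
    have hk: "h ((w, s), t) ! (t + j) = v ! j"
      if "(w, s) \<in> ?S" "t < m" "s \<le> j" "j < s + n" for w s t j
    proof -
      have "h ((w, s), t) ! (t + j) = Some (x (l w s + (j - s)))"
        unfolding h_def case_prod_conv by (rule window_nth) (use that assms in auto)
      moreover have "w \<in> ?N" "j - s < n" using that by auto
      then have "x (l w s + (j - s)) = w ! (j - s)" by (rule l)
      ultimately show ?thesis using vk[OF that(1,3,4)] by simp
    qed
    have hn: "h ((w, s), t) ! (t + (s + n)) \<noteq> v ! (s + n)" if "(w, s) \<in> ?S" "t < m" for w s t
    proof -
      have "h ((w, s), t) ! (t + (s + n)) = Some (x (l w s + n))"
        unfolding h_def case_prod_conv by (rule window_nth) (use that assms in auto)
      then show ?thesis using ln[of w s] that by auto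
    qed
    \<comment> \<open>A coincidence of windows at different shifts makes a long suffix of one of the two words
      periodic with the difference of the shifts as period.\<close>
    have no_shift: False
      if w: "(w, s) \<in> ?S" and w': "(w', s') \<in> ?S" and t: "t < t'" "t' < m"
        and eq: "h ((w, s), t) = h ((w', s'), t')"
      for w s w' s' t t'
    proof -
      define d where "d = t' - t"
      have d: "t' = t + d" "0 < d" "d < m" using t by (auto simp: d_def)
      have s: "s < m" "s' < m" and N: "w \<in> ?N" "w' \<in> ?N" using w w' by auto
      \<comment> \<open>The word starting further left in the common window becomes periodic: behind
        its first \<open>m\<close> letters the compared positions also lie inside the other
        word.\<close>
      show False
      proof (cases "s + t \<le> s' + t'")
        case True
        have "eventually_periodic m d w"
          unfolding eventually_periodic_def
        proof (intro conjI allI impI)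
          fix k assume k: "m \<le> k \<and> k + d < length w"
          then have k': "k + d < n" using len[OF N(1)] by simp
          have "Some (w ! (k + d)) = v ! (s + k + d)" using vk[OF w, of "s + k + d"] k' by simp
          also have "\<dots> = h ((w, s), t) ! (t + (s + k + d))" using hk[OF w, of t "s + k + d"] k' t by simp
          also have "\<dots> = h ((w', s'), t') ! (t' + (s + k))" using d eq by (simp add: ac_simps)
          also have "\<dots> = v ! (s + k)" using hk[OF w', of t' "s + k"] k k' s t d True by simp
          also have "\<dots> = Some (w ! k)" using vk[OF w, of "s + k"] k' by simp
          finally show "w ! k = w ! (k + d)" by simp
        qed (use d in auto)
        then show False using N(1) by blast
      next
        case False
        have "eventually_periodic m d w'"
          unfolding eventually_periodic_def
        proof (intro conjI allI impI)
          fix k assume k: "m \<le> k \<and> k + d < length w'"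
          then have k': "k + d < n" using len[OF N(2)] by simp
          have "Some (w' ! k) = v ! (s' + k)" using vk[OF w', of "s' + k"] k' by simp
          also have "\<dots> = h ((w', s'), t') ! (t' + (s' + k))" using hk[OF w', of t' "s' + k"] k' t by simp
          also have "\<dots> = h ((w, s), t) ! (t + (s' + k + d))" using d eq by (simp add: ac_simps)
          also have "\<dots> = v ! (s' + k + d)" using hk[OF w, of t "s' + k + d"] k k' s t d False by simp
          also have "\<dots> = Some (w' ! (k + d))" using vk[OF w', of "s' + k + d"] k' by simp
          finally show "w' ! k = w' ! (k + d)" by simp
        qed (use d in auto)
        then show False using N(2) by blast
      qed
    qed
    \<comment> \<open>For equal shifts and \<open>s < s'\<close> the word \<open>w'\<close> covers
      the position just behind \<open>w\<close>. There the window agrees with \<open>v\<close>,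
      against the choice of the extension of \<open>w\<close>.\<close>
    have no_slide: False
      if w: "(w, s) \<in> ?S" and w': "(w', s') \<in> ?S" and t: "t < m" and s: "s < s'"
        and eq: "h ((w, s), t) = h ((w', s'), t)"
      for w s w' s' t
    proof -
      have "s' < m" using w' by auto
      then have "h ((w', s'), t) ! (t + (s + n)) = v ! (s + n)"
        using hk[OF w', of t "s + n"] t s assms by simp
      then show False using hn[OF w t] eq by simp
    qed
    have "inj_on h (?S \<times> {..<m})"
    proof (rule inj_onI, unfold split_paired_all)
      fix w s t w' s' t'
      assume "((w, s), t) \<in> ?S \<times> {..<m}" "((w', s'), t') \<in> ?S \<times> {..<m}"
        and eq: "h ((w, s), t) = h ((w', s'), t')"
      then have w: "(w, s) \<in> ?S" and w': "(w', s') \<in> ?S" and t: "t < m" "t' < m" by blast+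
      have tt: "t = t'" using no_shift[OF w w' _ t(2) eq] no_shift[OF w' w _ t(1) eq[symmetric]]
        by (cases t t' rule: linorder_cases) blast+
      then have eq': "h ((w, s), t) = h ((w', s'), t)" using eq by simp
      have ss: "s = s'"
        using no_slide[OF w w' t(1) _ eq'] no_slide[OF w' w t(1) _ eq'[symmetric]]
        by (cases s s' rule: linorder_cases) blast+
      have N: "w \<in> ?N" "w' \<in> ?N" using w w' by auto
      have "w = w'"
      proof (rule nth_equalityI)
        fix k assume "k < length w"
        then show "w ! k = w' ! k"
          using vk[OF w, of "s + k"] vk[OF w', of "s + k"] ss len[OF N(1)] by simp
      qed (simp only: len[OF N(1)] len[OF N(2)])
      with tt ss show "((w, s), t) = ((w', s'), t')" by simp
    qed
    then have "card (?S \<times> {..<m}) = card (h ` (?S \<times> {..<m}))" by (simp only: card_image)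
    also have "\<dots> \<le> card ?Z"
      by (rule card_mono[OF finite_windows]) (auto simp: h_def)
    finally show ?thesis by (simp add: card_cartesian_product)
  qed
  have "card (?N \<times> {..<m}) = (\<Sum>v\<in>g ` (?N \<times> {..<m}). card {p \<in> ?N \<times> {..<m}. g p = v})"
    using finN unfolding card_eq_sum by (intro sum.image_gen) simp
  also have "\<dots> * m = (\<Sum>v\<in>g ` (?N \<times> {..<m}). card {p \<in> ?N \<times> {..<m}. g p = v} * m)"
    by (rule sum_distrib_right)
  also have "\<dots> \<le> (\<Sum>v\<in>g ` (?N \<times> {..<m}). card ?Z)" by (intro sum_mono fiber)
  also have "\<dots> = card (g ` (?N \<times> {..<m})) * card ?Z" by simp
  also have "\<dots> \<le> card ?Z * card ?Z"
    by (intro mult_right_mono card_mono[OF finite_windows]) (auto simp: g_def)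
  finally show ?thesis by (simp add: card_cartesian_product)
qed

text \<open>For large \<open>n\<close> the number of windows is at most a constant times
  \<open>m\<close>, so the two counts bound the periodic and the aperiodic factors by
  constants.\<close>

lemma bounded_right_special:
  fixes x :: "nat \<Rightarrow> 'a::finite"
  assumes "(\<lambda>n. real (factor_complexity x n)) \<in> O(\<lambda>n. real n)"
  shows "\<exists>K. \<forall>n. card (right_special x n) \<le> K"
proof -
  obtain c where "\<forall>\<^sub>F n in at_top. norm (real (factor_complexity x n)) \<le> c * norm (real n)"
    using assms by (auto elim!: landau_o.bigE)
  then obtain n0 where n0: "\<And>n. n \<ge> n0 \<Longrightarrow> real (factor_complexity x n) \<le> c * real n"
    by (auto simp: eventually_at_top_linorder)
  \<comment> \<open>With this \<open>D\<close>, the bound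
    \<open>2 * n * nat \<lceil>c\<rceil> + 2 * n + 1\<close> on the number of windows of length
    \<open>2 * n\<close> is at most \<open>D * n\<close>.\<close>
  define D where "D = 2 * nat \<lceil>c\<rceil> + 3"
  have big: "card (right_special x n) \<le> 7 * D + 7 * D * (7 * D)" if n: "n \<ge> max n0 4" for n
  proof -
    define m where "m = n div 4"
    have "n = 4 * m + n mod 4" "n mod 4 < 4" by (auto simp: m_def)
    then have "4 * m \<le> n" "0 < m" "n \<le> 4 * m + 3" using n by linarith+
    \<comment> \<open>The factor 7 comes from \<open>4 * m + 3 \<le> 7 * m\<close>, as
      \<open>m\<close> is positive.\<close>
    then have m: "4 * m \<le> n" "0 < m" "n \<le> 7 * m" by linarith+
    define Z where "Z = card (range (window x (2 * n)))"
    have "c * real (2 * n) \<le> real (nat \<lceil>c\<rceil>) * real (2 * n)"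
      by (intro mult_right_mono) linarith+
    then have "real (factor_complexity x (2 * n)) \<le> real (nat \<lceil>c\<rceil> * (2 * n))"
      using n0[of "2 * n"] n unfolding of_nat_mult by linarith
    then have "factor_complexity x (2 * n) \<le> nat \<lceil>c\<rceil> * (2 * n)" by linarith
    then have "Z \<le> nat \<lceil>c\<rceil> * (2 * n) + 2 * n + 1"
      using card_windows[of x "2 * n"] by (simp add: Z_def)
    also have "\<dots> \<le> D * n" using n by (simp add: D_def algebra_simps)
    also have "\<dots> \<le> 7 * D * m" using m(3) by simp
    finally have Z: "Z \<le> 7 * D * m" .
    let ?B = "{w \<in> right_special x n. \<exists>q. eventually_periodic m q w}"
    let ?N = "{w \<in> right_special x n. \<nexists>q. eventually_periodic m q w}"
    have "card ?B * m * m \<le> 7 * D * m * m"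
      by (intro mult_right_mono[OF order_trans[OF card_periodic_right_special[OF m(1,2)]
              Z[unfolded Z_def]]]) simp
    moreover have "card ?N * m * m \<le> (7 * D * m) * (7 * D * m)"
      using card_aperiodic_right_special[OF m(1,2), of x] mult_mono[OF Z Z]
      unfolding Z_def by linarith
    moreover have "card (right_special x n) \<le> card ?B + card ?N"
    proof -
      have "right_special x n = ?B \<union> ?N" by blast
      then have "card (right_special x n) = card (?B \<union> ?N)" by (rule arg_cong)
      also have "\<dots> \<le> card ?B + card ?N" by (rule card_Un_le)
      finally show ?thesis .
    qed
    then have "card (right_special x n) * (m * m) \<le> (card ?B + card ?N) * (m * m)"
      by (rule mult_le_mono1)
    ultimately have "card (right_special x n) * (m * m) \<le> (7 * D + 7 * D * (7 * D)) * (m * m)"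
      unfolding distrib_right by (simp only: mult.assoc mult.left_commute mult.commute)
    then show ?thesis using m(2) by simp
  qed
  define K where "K = max (7 * D + 7 * D * (7 * D)) (Max ((\<lambda>n. card (right_special x n)) ` {..max n0 4}))"
  have "card (right_special x n) \<le> K" for n
  proof (cases "n \<ge> max n0 4")
    case True
    then show ?thesis using big[OF True] by (simp add: K_def)
  next
    case False
    then have "card (right_special x n) \<le> Max ((\<lambda>n. card (right_special x n)) ` {..max n0 4})"
      by (intro Max_ge) auto
    then show ?thesis by (simp add: K_def)
  qed
  then show ?thesis by blast
qed

subsection \<open>Coding dimension\<close>

text \<open>Each winning history of length \<open>n\<close> has at least
  \<open>\<alpha> n + 1\<close> winning extensions by a letter, and different histories have
  different extensions.\<close>

lemma card_wins_Suc:
  fixes X :: "(nat \<Rightarrow> 'a::finite) set"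
  shows "(\<alpha> n + 1) * card {h. length h = n \<and> wins X \<alpha> h} \<le> card {h. length h = Suc n \<and> wins X \<alpha> h}"
proof -
  let ?P = "\<lambda>n. {h. length h = n \<and> wins X \<alpha> h}"
  have fin: "finite (?P n)" for n
    by (rule finite_subset[OF _ finite_lists_length_eq[of UNIV n]]) auto
  have "\<forall>h\<in>?P n. \<exists>A. card A = \<alpha> n + 1 \<and> (\<forall>a\<in>A. wins X \<alpha> (h @ [a]))"
    using wins_unfold by blast
  from bchoice[OF this] obtain A
    where A: "\<forall>h\<in>?P n. card (A h) = \<alpha> n + 1 \<and> (\<forall>a\<in>A h. wins X \<alpha> (h @ [a]))" ..
  have "card (Sigma (?P n) A) = (\<Sum>h\<in>?P n. card (A h))"
    using fin by (simp add: card_SigmaI)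
  also have "\<dots> = (\<alpha> n + 1) * card (?P n)" using A by simp
  finally have "(\<alpha> n + 1) * card (?P n) = card (Sigma (?P n) A)" ..
  also have "\<dots> \<le> card (?P (Suc n))"
  proof (rule card_inj_on_le[where f = "\<lambda>(h, a). h @ [a]"])
    show "inj_on (\<lambda>(h, a). h @ [a]) (Sigma (?P n) A)" by (auto simp: inj_on_def)
    show "(\<lambda>(h, a). h @ [a]) ` Sigma (?P n) A \<subseteq> ?P (Suc n)" using A by auto
  qed (rule fin)
  finally show ?thesis .
qed

lemma card_wins_ge:
  fixes X :: "(nat \<Rightarrow> 'a::finite) set"
  assumes "wins X \<alpha> []"
  shows "2 ^ card {i. i < n \<and> \<alpha> i \<noteq> 0} \<le> card {h. length h = n \<and> wins X \<alpha> h}"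
proof (induction n)
  case 0
  have "{h. length h = 0 \<and> wins X \<alpha> h} = {[]}" using assms by auto
  then show ?case by simp
next
  case (Suc n)
  have "card {i. i < Suc n \<and> \<alpha> i \<noteq> 0} = card {i. i < n \<and> \<alpha> i \<noteq> 0} + (if \<alpha> n = 0 then 0 else 1)"
  proof -
    have "{i. i < Suc n \<and> \<alpha> i \<noteq> 0} =
        (if \<alpha> n = 0 then {i. i < n \<and> \<alpha> i \<noteq> 0} else insert n {i. i < n \<and> \<alpha> i \<noteq> 0})"
      by (auto simp: less_Suc_eq)
    then show ?thesis by simp
  qed
  then have "(2 :: nat) ^ card {i. i < Suc n \<and> \<alpha> i \<noteq> 0} \<le> (\<alpha> n + 1) * 2 ^ card {i. i < n \<and> \<alpha> i \<noteq> 0}"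
    by (auto simp: mult_le_mono1)
  also have "\<dots> \<le> (\<alpha> n + 1) * card {h. length h = n \<and> wins X \<alpha> h}"
    using Suc by (rule mult_le_mono2)
  also note card_wins_Suc
  finally show ?case .
qed

text \<open>A nonzero entry gives Alice a set with at least two letters. Each of them leads to a
  factor of \<open>x\<close>, and one of them differs from any prescribed letter.\<close>

lemma wins_right_special:
  assumes "\<alpha> n \<noteq> 0"
  shows "{h. length h = n \<and> wins (generated_subshift x) \<alpha> h} \<subseteq> right_special x n"
proof
  fix h assume "h \<in> {h. length h = n \<and> wins (generated_subshift x) \<alpha> h}"
  then have h: "length h = n" "wins (generated_subshift x) \<alpha> h" by auto
  obtain A where A: "card A = \<alpha> n + 1" "\<And>a. a \<in> A \<Longrightarrow> wins (generated_subshift x) \<alpha> (h @ [a])"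
    using h wins_unfold by blast
  have "\<exists>i. (\<forall>k<n. x (i + k) = h ! k) \<and> x (i + n) \<noteq> c" for c
  proof -
    have "\<not> A \<subseteq> {c}"
    proof
      assume "A \<subseteq> {c}"
      then have "card A \<le> 1" using card_mono[of "{c}" A] by simp
      then show False using A(1) assms by simp
    qed
    then obtain a where a: "a \<in> A" "a \<noteq> c" by blast
    obtain i where i: "h @ [a] = factor_at x i (length (h @ [a]))"
      using wins_imp_factor[OF A(2)[OF a(1)]] by blast
    have hk: "(h @ [a]) ! k = x (i + k)" if "k \<le> n" for k
      by (subst i) (use that h(1) in \<open>simp del: upt_Suc\<close>)
    have "x (i + k) = h ! k" if "k < n" for k
      using hk[of k] that h(1) by (simp add: nth_append)
    moreover have "x (i + n) = a" using hk[of n] h(1) by (simp add: nth_append)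
    ultimately have "\<forall>k<n. x (i + k) = h ! k" "x (i + n) = a" by blast+
    then show ?thesis using a(2) by blast
  qed
  then show "h \<in> right_special x n" using h(1) by (simp add: right_special_def)
qed

lemma finite_coding_dimension_winning_shift:
  fixes x :: "nat \<Rightarrow> 'a::finite"
  assumes "(\<lambda>n. real (factor_complexity x n)) \<in> O(\<lambda>n. real n)"
  shows "finite_coding_dimension (winning_shift (generated_subshift x))"
proof -
  obtain K where K: "\<And>n. card (right_special x n) \<le> K"
    using bounded_right_special[OF assms] by blast
  have "seq_sum_le y (Suc K * CARD('a))" if y: "y \<in> winning_shift (generated_subshift x)" for y
  proof -
    have wins: "wins (generated_subshift x) y []" using y by (simp add: winning_shift_iff)
    \<comment> \<open>With \<open>k\<close> earlier nonzero entries there are at least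
      \<open>2 ^ k\<close> winning histories, all right special; the crude bound
      \<open>k < 2 ^ k\<close> suffices.\<close>
    have below: "card {i. i < n \<and> y i \<noteq> 0} \<le> K" if "y n \<noteq> 0" for n
    proof -
      have "card {i. i < n \<and> y i \<noteq> 0} \<le> 2 ^ card {i. i < n \<and> y i \<noteq> 0}"
        by (simp add: less_imp_le)
      also have "\<dots> \<le> card {h. length h = n \<and> wins (generated_subshift x) y h}"
        by (rule card_wins_ge[OF wins])
      also have "\<dots> \<le> card (right_special x n)"
        by (rule card_mono[OF finite_subset[OF right_special_subset finite_factors]
              wins_right_special[of y n x, OF that]])
      also have "\<dots> \<le> K" by (rule K)
      finally show ?thesis .
    qed
    \<comment> \<open>The support is not yet known to be finite, so its finite subsets are bounded
      first: all elements of \<open>F\<close> except the largest lie below a nonzero entry.\<close>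
    have "card F \<le> Suc K" if F: "F \<subseteq> {i. y i \<noteq> 0}" "finite F" for F
    proof (cases "F = {}")
      case False
      have "F - {Max F} \<subseteq> {i. i < Max F \<and> y i \<noteq> 0}"
      proof
        fix i assume "i \<in> F - {Max F}"
        then show "i \<in> {i. i < Max F \<and> y i \<noteq> 0}"
          using F Max_ge[OF F(2), of i] by (auto intro!: le_neq_trans)
      qed
      then have "card (F - {Max F}) \<le> card {i. i < Max F \<and> y i \<noteq> 0}" by (intro card_mono) auto
      also have "\<dots> \<le> K" using Max_in[OF F(2) False] F(1) by (intro below) auto
      finally show ?thesis using Max_in[OF F(2) False] F(2) by (simp add: card_Diff_singleton)
    qed simp
    then have fin: "finite {i. y i \<noteq> 0}" "card {i. y i \<noteq> 0} \<le> Suc K"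
      using finite_if_finite_subsets_card_bdd[of "{i. y i \<noteq> 0}" "Suc K"] by auto
    have "(\<Sum>i\<in>{i. y i \<noteq> 0}. y i) \<le> card {i. y i \<noteq> 0} * CARD('a)"
      by (rule sum_bounded_above[where K = "CARD('a)", simplified])
        (use y in \<open>auto simp: winning_shift_def less_imp_le\<close>)
    also have "\<dots> \<le> Suc K * CARD('a)" using fin(2) by (rule mult_le_mono1)
    finally show ?thesis using fin(1) by (simp add: seq_sum_le_def)
  qed
  then show ?thesis unfolding finite_coding_dimension_def by blast
qed

theorem mainTheorem1:
  fixes rep :: "nat \<Rightarrow> 'b::finite list"
    and x :: "nat \<Rightarrow> 'a::finite"
  assumes "ANS rep"
    and "addable rep"
    and "automatic rep x"
    and "(\<lambda>n. real (factor_complexity x n)) \<in> O(\<lambda>n. real n)"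
  shows "codable rep (winning_shift (generated_subshift x))"
proof -
  interpret addable_system rep
    by unfold_locales (use assms(1,2) in \<open>auto simp: ANS_def\<close>)
  show ?thesis
    unfolding codable_def
    using weakly_codable_winning_shift[OF assms(3)] finite_coding_dimension_winning_shift[OF assms(4)]
    by blast
qed

end
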